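(* Let $\widehat h_n\in\mathcal{K}_+$ be expressed on $[0,X_{(n)})$ as $$\widehat h_n(t)=\widehat a+\sum_{j=1}^k\widehat\nu_j(\tau_j-t)_++\sum_{j=1}^m\widehat\mu_j(t-\eta_j)_+ ,\qquad \widehat a,\widehat\nu_j,\widehat\mu_j\ge 0,$$ where $\tau_1<\dots<\tau_k$ are the points of change of slope of $\widehat h_n$ where $\widehat h_n$ is decreasing, $\eta_1<\dots<\eta_m$ (with $\eta_j>0$) are the points of change of slope where $\widehat h_n$ is increasing, and $\tau_k\le\eta_1$. Then $\widehat h_n$ minimizes $\varphi_n$ over $\mathcal{K}_+$ (and hence is the MLE) if and only if all of the following hold: (1) $\displaystyle\int_0^x\frac{x-t}{\widehat h_n(t)}\,d\widetilde{\mathbb{F}}_n(t)\le\int_0^x\int_0^t\mathbb{S}_n(s)\,ds\,dt$ for all $x\ge0$, with equality at $x=\tau_i$ for $i=1,\dots,k$; (2) $\displaystyle\int_x^\infty\frac{t-x}{\widehat h_n(t)}\,d\widetilde{\mathbb{F}}_n(t)\le\int_x^\infty\int_t^\infty\mathbb{S}_n(s)\,ds\,dt$ for all $x\ge0$, with equality at $x=\eta_j$ for $j=1,\dots,m$; (3) $\displaystyle\int_0^\infty\frac{1}{\widehat h_n(t)}\,d\widetilde{\mathbb{F}}_n(t)\le\int_0^\infty\mathbb{S}_n(t)\,dt$; (4) $\displaystyle\int_0^\infty\widehat H_n(t)\,d\mathbb{F}_n(t)=1-\frac1n$, where $\widehat H_n(t)=\int_0^t\widehat h_n(s)\,ds$.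 Moreover, the minimizer $\widehat h_n$ satisfies $$\int_0^x\widehat h_n(t)\,\mathbb{S}_n(t)\,dt=\mathbb{F}_n(x)$$ for $x\in\{\tau_1,\dots,\tau_k,\eta_1,\dots,\eta_m\}$.
   Context: $0<X_{(1)}<\dots<X_{(n)}$ are the order statistics of an i.i.d. sample $X_1,\dots,X_n$. $\mathbb{F}_n(t)=\frac1n\sum_{i=1}^n1_{[0,t]}(X_i)$ is the empirical distribution function, $\mathbb{S}_n=1-\mathbb{F}_n$, and $\widetilde{\mathbb{F}}_n(t)=\frac1n\sum_{i=1}^{n-1}1_{[0,t]}(X_{(i)})$. $\mathcal{K}_+$ is the set of non-negative convex functions on $[0,X_{(n)})$. For $h\in\mathcal{K}_+$, $H(t)=\int_0^th(s)\,ds$ and $$\varphi_n(h)=\int_0^\infty\{H(t)-\log h(t)\,1_{t\ne X_{(n)}}\}\,d\mathbb{F}_n(t).$$ Minimizing $\varphi_n$ over $\mathcal{K}_+$ is equivalent to maximizing the modified likelihood $\prod_{i=1}^{n-1}h(X_{(i)})e^{-H(X_{(i)})}\times e^{-H(X_{(n)})}$; the minimizer, extended by $+\infty$ on $[X_{(n)},\infty)$, is called the MLE. Notation: $(u)_+=\max(u,0)$. *)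

theory Defs
  imports "HOL-Analysis.Analysis"
begin

text \<open>
  A realisation of a sample of size \<open>n\<close> is a function \<open>X\<close> whose values at \<open>1, \<dots>, n\<close> matter;
  \<open>order_stat n X i\<close> is the \<open>i\<close>-th smallest of \<open>X 1, \<dots>, X n\<close>, for \<open>1 \<le> i \<le> n\<close>.
\<close>

definition order_stat :: "nat \<Rightarrow> (nat \<Rightarrow> real) \<Rightarrow> nat \<Rightarrow> real" where
  "order_stat n X i = sort (map X [1..<Suc n]) ! (i - 1)"

definition emp_df :: "nat \<Rightarrow> (nat \<Rightarrow> real) \<Rightarrow> real \<Rightarrow> real" where
  "emp_df n X t = (1 / real n) * (\<Sum>i\<in>{1..n}. indicator {0..t} (X i))"

definition emp_surv :: "nat \<Rightarrow> (nat \<Rightarrow> real) \<Rightarrow> real \<Rightarrow> real" where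
  "emp_surv n X t = 1 - emp_df n X t"

definition emp_df_tilde :: "nat \<Rightarrow> (nat \<Rightarrow> real) \<Rightarrow> real \<Rightarrow> real" where
  "emp_df_tilde n X t = (1 / real n) * (\<Sum>i\<in>{1..<n}. indicator {0..t} (order_stat n X i))"

text \<open>Integrals with respect to these distribution functions are Lebesgue-Stieltjes integrals.\<close>

abbreviation emp_measure :: "nat \<Rightarrow> (nat \<Rightarrow> real) \<Rightarrow> real measure" where
  "emp_measure n X \<equiv> interval_measure (emp_df n X)"

abbreviation emp_measure_tilde :: "nat \<Rightarrow> (nat \<Rightarrow> real) \<Rightarrow> real measure" where
  "emp_measure_tilde n X \<equiv> interval_measure (emp_df_tilde n X)"

text \<open>
  Hazards are total functions of which only the values on \<open>{0..<order_stat n X n}\<close> are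
  constrained. The values elsewhere do not influence any of the integrals below.
\<close>

definition K_plus :: "nat \<Rightarrow> (nat \<Rightarrow> real) \<Rightarrow> (real \<Rightarrow> real) set" where
  "K_plus n X = {h. convex_on {0..<order_stat n X n} h \<and> (\<forall>t\<in>{0..<order_stat n X n}. 0 \<le> h t)}"

text \<open>
  The cumulative hazard is extended-valued: a convex hazard may be unbounded near
  \<open>order_stat n X n\<close>, and its integral up to that point may be infinite.
\<close>

definition cum_hazard :: "(real \<Rightarrow> real) \<Rightarrow> real \<Rightarrow> ennreal" where
  "cum_hazard h t = (\<integral>\<^sup>+ s\<in>{0..t}. ennreal (h s) \<partial>lborel)"

text \<open>The logarithm with the convention that the logarithm of zero is minus infinity.\<close>

definition elog :: "real \<Rightarrow> ereal" where
  "elog y = (if y \<le> 0 then -\<infinity> else ereal (ln y))"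

text \<open>
  The extended-valued integral over a set, as the integral of the positive part minus that of the
  negative part; \<^const>\<open>e2ennreal\<close> sends negative arguments to zero.
\<close>

definition ereal_integral :: "'a measure \<Rightarrow> 'a set \<Rightarrow> ('a \<Rightarrow> ereal) \<Rightarrow> ereal" where
  "ereal_integral M A f =
     enn2ereal (\<integral>\<^sup>+ t\<in>A. e2ennreal (f t) \<partial>M) - enn2ereal (\<integral>\<^sup>+ t\<in>A. e2ennreal (- f t) \<partial>M)"

definition phi :: "nat \<Rightarrow> (nat \<Rightarrow> real) \<Rightarrow> (real \<Rightarrow> real) \<Rightarrow> ereal" where
  "phi n X h = ereal_integral (emp_measure n X) {0..}
     (\<lambda>t. enn2ereal (cum_hazard h t) - (if t \<noteq> order_stat n X n then elog (h t) else 0))"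

definition minimizes_phi :: "nat \<Rightarrow> (nat \<Rightarrow> real) \<Rightarrow> (real \<Rightarrow> real) \<Rightarrow> bool" where
  "minimizes_phi n X h \<longleftrightarrow> is_arg_min (phi n X) (\<lambda>g. g \<in> K_plus n X) h"

definition extend_infinity :: "nat \<Rightarrow> (nat \<Rightarrow> real) \<Rightarrow> (real \<Rightarrow> real) \<Rightarrow> real \<Rightarrow> ereal" where
  "extend_infinity n X h t = (if t < order_stat n X n then ereal (h t) else \<infinity>)"

definition is_MLE :: "nat \<Rightarrow> (nat \<Rightarrow> real) \<Rightarrow> (real \<Rightarrow> ereal) \<Rightarrow> bool" where
  "is_MLE n X g \<longleftrightarrow>
     (\<exists>h. minimizes_phi n X h \<and> (\<forall>t\<ge>0. g t = extend_infinity n X h t))"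

text \<open>
  The points of change of slope of \<open>h\<close>, as a function on \<open>{0..<b}\<close>, at which \<open>h\<close> is decreasing
  (on the left of the point), respectively increasing (on the right of the point). The minimum
  of a V-shaped function belongs to both sets.
\<close>

definition slope_change_at :: "(real \<Rightarrow> real) \<Rightarrow> real \<Rightarrow> real \<Rightarrow> real \<Rightarrow> bool" where
  "slope_change_at h p l r \<longleftrightarrow>
     (h has_real_derivative l) (at_left p) \<and> (h has_real_derivative r) (at_right p) \<and> l \<noteq> r"

definition decreasing_slope_changes :: "(real \<Rightarrow> real) \<Rightarrow> real \<Rightarrow> real set" where
  "decreasing_slope_changes h b = {p. 0 < p \<and> p < b \<and> (\<exists>l r. slope_change_at h p l r \<and> l < 0)}"

definition increasing_slope_changes :: "(real \<Rightarrow> real) \<Rightarrow> real \<Rightarrow> real set" where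
  "increasing_slope_changes h b = {p. 0 < p \<and> p < b \<and> (\<exists>l r. slope_change_at h p l r \<and> 0 < r)}"

end

theory Submission
  imports Defs
begin

text \<open>
  The function \<open>phi\<close> is convex, so a point of the convex cone \<open>K_plus\<close> is a minimizer as soon as
  its directional derivatives are nonnegative towards the cone and zero along its own ray. Both
  distribution functions are step functions, so every integral against them is a finite sum over
  the ordered sample \<open>x 1 < \<dots> < x n = b\<close>. Exchanging the order of integration turns
  \<open>\<integral>P d\<F>\<^sub>n\<close>, with \<open>P\<close> the primitive of a direction \<open>p\<close>, into \<open>\<integral>p(s) \<S>\<^sub>n(s) ds\<close>. The derivative of
  \<open>phi\<close> at \<open>h\<close> in the direction \<open>p\<close> is therefore the linear functional
  \<open>dir_deriv h p = \<integral>p \<S>\<^sub>n ds - \<integral>(p/h) d\<F>~\<^sub>n\<close>, and the four conditions are statements about its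
  values: the inequalities say that it is nonnegative at the hinges \<open>(c - t)\<^sub>+\<close> and \<open>(t - c)\<^sub>+\<close> and
  at the constant \<open>1\<close>, the equalities that it vanishes at the hinges of \<open>h\<close>, and the last condition
  that \<open>dir_deriv h h = 0\<close>.

  Necessity is obtained by perturbing \<open>h\<close>. Hinges, constants and multiples of \<open>h\<close> may be added to
  \<open>h\<close>. A small multiple of a hinge of \<open>h\<close> may also be subtracted, because its coefficient is
  positive: otherwise \<open>h\<close> would not change slope there while decreasing, respectively increasing
  (lemmas \<open>\<nu>_pos\<close> and \<open>\<mu>_pos\<close>).

  Sufficiency rests on \<open>convex_hinge_minorant\<close>. A competitor \<open>g\<close> enters \<open>phi\<close> only through its
  integrals and its values at the finitely many sample points, so it may be replaced by a smaller
  function that agrees with it at these points. Such a function can be built from supporting lines as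
  a nonnegative combination of hinges and a constant, where \<open>dir_deriv h\<close> is known to be
  nonnegative. The tangent inequality for the logarithm then compares the two values of \<open>phi\<close>.

  For the last assertion let \<open>z\<close> be a point of change of slope. The nonnegative function
  \<open>c \<mapsto> dir_deriv h (c - t)\<^sub>+\<close> (or its mirror image) has a zero, hence a minimum, at \<open>z\<close>. Its one-sided
  derivatives there are, up to sign, the values of \<open>dir_deriv h\<close> at indicators of half-lines, which must vanish
  (\<open>dir_deriv_half_line_eq_0\<close>). The function \<open>h\<close> cut off at \<open>z\<close> is a combination of such an
  indicator and of hinges at which the functional vanishes, so the functional vanishes at
  \<open>h 1\<^bsub>[0,z]\<^esub>\<close> too. This is the claimed identity.
\<close>

section \<open>Lebesgue-Stieltjes measures of step functions\<close>

lemma interval_measure_jumps: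
  fixes x :: "'i \<Rightarrow> real" and w :: real
  assumes I: "finite I" and w: "0 \<le> w"
  shows "interval_measure (\<lambda>t. w * (\<Sum>i\<in>I. indicator {x i..} t)) =
    distr (point_measure I (\<lambda>_. ennreal w)) borel x" (is "interval_measure ?F = ?D")
proof (rule measure_eqI_generator_eq[where \<Omega> = UNIV and E = "range (\<lambda>(a, b). {a <.. b::real})"
        and A = "\<lambda>i::nat. {- real i <.. real i}"])
  have mono: "?F s \<le> ?F t" if "s \<le> t" for s t
    using that by (intro mult_left_mono sum_mono w) (auto simp: indicator_def)
  have cont: "continuous (at_right t) ?F" for t
  proof -
    have "continuous (at_right t) (\<lambda>t. indicator {x i..} t :: real)" for i
    proof -
      have "eventually (\<lambda>s. indicator {x i..} s = (indicator {x i..} t :: real)) (at_right t)"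
      proof (cases "x i \<le> t")
        case True
        then show ?thesis by (auto simp: eventually_at_filter indicator_def)
      next
        case False
        then have "eventually (\<lambda>s. s \<in> {t<..<x i}) (at_right t)"
          by (intro eventually_at_right_real) auto
        then show ?thesis using False by (auto elim!: eventually_mono simp: indicator_def)
      qed
      then show ?thesis
        unfolding continuous_within by (intro tendsto_eventually)
    qed
    then show ?thesis by (intro continuous_intros)
  qed
  show "emeasure (interval_measure ?F) Y = emeasure ?D Y" if "Y \<in> range (\<lambda>(a, b). {a <.. b::real})" for Y
  proof -
    obtain a b where Y: "Y = {a<..b}" using \<open>Y \<in> _\<close> by auto
    show ?thesis
    proof (cases "a \<le> b")
      case False
      then show ?thesis by (simp add: Y)
    next
      case True
      have "?F b - ?F a = w * (\<Sum>i\<in>I. indicator {x i..} b - indicator {x i..} a)"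
        by (simp add: algebra_simps sum_subtractf)
      also have "(\<Sum>i\<in>I. indicator {x i..} b - indicator {x i..} a :: real) = (\<Sum>i\<in>I. if x i \<in> Y then 1 else 0)"
        using True by (intro sum.cong) (auto simp: indicator_def Y)
      also have "\<dots> = real (card (x -` Y \<inter> I))"
        using I by (simp add: sum.If_cases Int_def conj_commute vimage_def)
      finally have F: "?F b - ?F a = w * real (card (x -` Y \<inter> I))" .
      have "emeasure (interval_measure ?F) Y = ennreal (w * real (card (x -` Y \<inter> I)))"
        unfolding Y by (subst emeasure_interval_measure_Ioc[OF True mono cont]) (simp_all add: F Y[symmetric])
      also have "\<dots> = emeasure ?D Y"
        using I w by (subst emeasure_distr)
          (auto simp: Y space_point_measure emeasure_point_measure_finite ennreal_mult ennreal_of_nat_eq_real_of_nat mult.commute)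
      finally show ?thesis .
    qed
  qed
  show "emeasure (interval_measure ?F) {- real i <.. real i} \<noteq> \<infinity>" for i
    by (subst emeasure_interval_measure_Ioc[OF _ mono cont]) auto
  show "(\<Union>i. {- real i <.. real i}) = UNIV"
    by (auto simp: set_eq_iff) (metis abs_le_iff abs_less_iff dual_order.strict_trans1 reals_Archimedean2 less_imp_le minus_less_iff)
qed (auto simp: borel_sigma_sets_Ioc Int_stable_def)


text \<open>
  The measure is carried by finitely many points, so any integrand agrees almost everywhere with a
  simple function. Arbitrary integrands are admitted because hazards are arbitrary functions outside
  the range of the data.
\<close>

lemma nn_integral_interval_measure_jumps:
  fixes x :: "'i \<Rightarrow> real" and w :: real and f :: "real \<Rightarrow> ennreal"
  assumes I: "finite I" and w: "0 \<le> w"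
  shows "(\<integral>\<^sup>+ t. f t \<partial>interval_measure (\<lambda>t. w * (\<Sum>i\<in>I. indicator {x i..} t))) = ennreal w * (\<Sum>i\<in>I. f (x i))"
proof -
  let ?D = "distr (point_measure I (\<lambda>_. ennreal w)) borel x"
  let ?g = "\<lambda>t. \<Sum>z\<in>x ` I. f z * indicator {z} t"
  have x: "x \<in> measurable (point_measure I (\<lambda>_. ennreal w)) borel"
    by (simp add: measurable_def space_point_measure sets_point_measure)
  have g: "?g (x i) = f (x i)" if "i \<in> I" for i
  proof -
    have "?g (x i) = (\<Sum>z\<in>x ` I. if z = x i then f z else 0)"
      by (intro sum.cong) (auto simp: indicator_def)
    also have "\<dots> = f (x i)"
      using I that by (subst sum.delta) auto
    finally show ?thesis .
  qed
  have "AE t in ?D. t \<in> x ` I"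
    using I x by (subst AE_distr_iff) (auto intro!: AE_I2 simp: space_point_measure finite_imp_closed)
  then have "(\<integral>\<^sup>+ t. f t \<partial>?D) = (\<integral>\<^sup>+ t. ?g t \<partial>?D)"
    by (intro nn_integral_cong_AE) (auto simp: g)
  also have "\<dots> = (\<integral>\<^sup>+ i. ?g (x i) \<partial>point_measure I (\<lambda>_. ennreal w))"
    using x by (subst nn_integral_distr) auto
  also have "\<dots> = (\<Sum>i\<in>I. ennreal w * ?g (x i))"
    using I by (simp add: nn_integral_point_measure_finite)
  also have "\<dots> = ennreal w * (\<Sum>i\<in>I. f (x i))"
    by (simp add: g sum_distrib_left)
  finally show ?thesis
    by (simp add: interval_measure_jumps[OF I w])
qed

section \<open>The ordered sample\<close>

lemma sum_order_stat:
  fixes X :: "nat \<Rightarrow> real" and f :: "real \<Rightarrow> 'a::comm_monoid_add"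
  shows "(\<Sum>i\<in>{1..n}. f (order_stat n X i)) = (\<Sum>i\<in>{1..n}. f (X i))"
proof -
  have "(\<Sum>i\<in>{1..n}. f (order_stat n X i)) = (\<Sum>i<n. f (sort (map X [1..<Suc n]) ! i))"
    by (rule sum.reindex_bij_witness[of _ Suc "\<lambda>i. i - 1"]) (auto simp: order_stat_def)
  also have "\<dots> = sum_list (map f (sort (map X [1..<Suc n])))"
    by (simp add: sum_list_sum_nth atLeast0LessThan del: upt_Suc)
  also have "\<dots> = sum_mset (image_mset f (mset (sort (map X [1..<Suc n]))))"
    by (metis mset_map sum_mset_sum_list)
  also have "\<dots> = sum_list (map (f \<circ> X) [1..<Suc n])"
    by (simp only: mset_sort) (metis map_map mset_map sum_mset_sum_list)
  also have "\<dots> = (\<Sum>i\<in>{1..n}. f (X i))"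
    by (simp add: interv_sum_list_conv_sum_set_nat atLeastLessThanSuc_atLeastAtMost o_def del: upt_Suc)
  finally show ?thesis .
qed

locale ordered_sample =
  fixes n :: nat and X :: "nat \<Rightarrow> real"
  assumes n_pos: "1 \<le> n"
    and order_stat_1_pos: "0 < order_stat n X 1"
    and order_stat_strict: "strict_mono_on {1..n} (order_stat n X)"
begin

abbreviation x :: "nat \<Rightarrow> real" where "x \<equiv> order_stat n X"
abbreviation b :: real where "b \<equiv> x n"

lemma x_pos: "0 < x i" if "i \<in> {1..n}"
  using strict_mono_onD[OF order_stat_strict, of 1 i] order_stat_1_pos that
  by (cases "i = 1") auto

lemma x_less_b: "x i < b" if "i \<in> {1..<n}"
  using strict_mono_onD[OF order_stat_strict, of i n] that by auto

lemma x_le_b: "x i \<le> b" if "i \<in> {1..n}"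
  using x_less_b[of i] that by (cases "i = n") auto

lemma b_pos: "0 < b"
  using x_pos[of n] n_pos by auto

lemma emp_df_jumps: "emp_df n X = (\<lambda>t. 1 / real n * (\<Sum>i\<in>{1..n}. indicator {x i..} t))"
proof
  fix t
  have "emp_df n X t = 1 / real n * (\<Sum>i\<in>{1..n}. indicator {0..t} (x i))"
    using sum_order_stat[where f="indicator {0..t} :: real \<Rightarrow> real" and n=n and X=X] by (simp add: emp_df_def)
  also have "(\<Sum>i\<in>{1..n}. indicator {0..t} (x i)) = (\<Sum>i\<in>{1..n}. indicator {x i..} t :: real)"
    using x_pos by (intro sum.cong) (auto simp: indicator_def less_imp_le)
  finally show "emp_df n X t = 1 / real n * (\<Sum>i\<in>{1..n}. indicator {x i..} t)" .
qed

lemma emp_df_tilde_jumps: "emp_df_tilde n X = (\<lambda>t. 1 / real n * (\<Sum>i\<in>{1..<n}. indicator {x i..} t))"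
proof
  fix t
  have "(\<Sum>i\<in>{1..<n}. indicator {0..t} (x i)) = (\<Sum>i\<in>{1..<n}. indicator {x i..} t :: real)"
    using x_pos by (intro sum.cong) (auto simp: indicator_def less_imp_le)
  then show "emp_df_tilde n X t = 1 / real n * (\<Sum>i\<in>{1..<n}. indicator {x i..} t)"
    by (simp add: emp_df_tilde_def)
qed

lemma nn_integral_emp_measure:
  "(\<integral>\<^sup>+ t. f t \<partial>emp_measure n X) = ennreal (1 / real n) * (\<Sum>i\<in>{1..n}. f (x i))"
  by (simp add: emp_df_jumps nn_integral_interval_measure_jumps del: times_divide_eq_left)

lemma nn_integral_emp_measure_tilde:
  "(\<integral>\<^sup>+ t. f t \<partial>emp_measure_tilde n X) = ennreal (1 / real n) * (\<Sum>i\<in>{1..<n}. f (x i))"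
  by (simp add: emp_df_tilde_jumps nn_integral_interval_measure_jumps del: times_divide_eq_left)

end

section \<open>The criterion function as a finite sum\<close>

lemma enn2ereal_sum: "enn2ereal (\<Sum>i\<in>I. f i) = (\<Sum>i\<in>I. enn2ereal (f i))"
  by (induction I rule: infinite_finite_induct) (auto simp: zero_ennreal.rep_eq plus_ennreal.rep_eq)

lemma sum_ereal_minus_real:
  fixes f :: "'i \<Rightarrow> ereal"
  assumes "finite I"
  shows "(\<Sum>i\<in>I. f i - ereal (r i)) = (\<Sum>i\<in>I. f i) - ereal (\<Sum>i\<in>I. r i)"
  using assms
proof (induction I)
  case (insert i I)
  then show ?case
    by (cases "f i"; cases "\<Sum>i\<in>I. f i") auto
qed auto

text \<open>
  Splitting into positive and negative parts commutes with finite sums as long as no summand is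
  \<open>-\<infinity>\<close>: the negative parts are then real, and only they have to be moved across the
  subtraction.
\<close>

lemma ereal_pos_minus_neg_part_sum:
  fixes u :: "'i \<Rightarrow> ereal"
  assumes I: "finite I" and u: "\<And>i. i \<in> I \<Longrightarrow> u i \<noteq> - \<infinity>" and c: "0 < c"
  shows "enn2ereal (ennreal c * (\<Sum>i\<in>I. e2ennreal (u i))) - enn2ereal (ennreal c * (\<Sum>i\<in>I. e2ennreal (- u i)))
    = ereal c * (\<Sum>i\<in>I. u i)"
proof -
  define r where "r i = max 0 (- real_of_ereal (u i))" for i
  have r: "e2ennreal (- u i) = ennreal (r i)" if "i \<in> I" for i
    using u[OF that] by (cases "u i") (auto simp: r_def max_def ennreal_neg e2ennreal_neg)
  have "u i = enn2ereal (e2ennreal (u i)) - ereal (r i)" if "i \<in> I" for i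
  proof (cases "u i")
    case (real v)
    then show ?thesis
      by (cases "0 \<le> v") (auto simp: r_def ennreal_neg zero_ennreal.rep_eq)
  qed (use u[OF that] in \<open>auto simp: top_ennreal.rep_eq\<close>)
  then have "(\<Sum>i\<in>I. u i) = (\<Sum>i\<in>I. enn2ereal (e2ennreal (u i)) - ereal (r i))"
    by (rule sum.cong[OF refl])
  also have "\<dots> = (\<Sum>i\<in>I. enn2ereal (e2ennreal (u i))) - ereal (\<Sum>i\<in>I. r i)"
    by (rule sum_ereal_minus_real[OF I])
  also have "ereal c * \<dots> = ereal c * (\<Sum>i\<in>I. enn2ereal (e2ennreal (u i))) - ereal (c * (\<Sum>i\<in>I. r i))"
    using c by (cases "\<Sum>i\<in>I. enn2ereal (e2ennreal (u i))") (auto simp: algebra_simps)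
  finally have *: "ereal c * (\<Sum>i\<in>I. u i) = ereal c * (\<Sum>i\<in>I. enn2ereal (e2ennreal (u i))) - ereal (c * (\<Sum>i\<in>I. r i))" .
  have "(\<Sum>i\<in>I. e2ennreal (- u i)) = ennreal (\<Sum>i\<in>I. r i)"
    using r by (simp add: r_def)
  moreover have "0 \<le> (\<Sum>i\<in>I. r i)"
    by (simp add: r_def sum_nonneg)
  ultimately have "enn2ereal (ennreal c * (\<Sum>i\<in>I. e2ennreal (- u i))) = ereal (c * (\<Sum>i\<in>I. r i))"
    using c by (simp flip: ennreal_mult)
  moreover have "enn2ereal (ennreal c * (\<Sum>i\<in>I. e2ennreal (u i))) = ereal c * (\<Sum>i\<in>I. enn2ereal (e2ennreal (u i)))"
    using c by (simp only: times_ennreal.rep_eq enn2ereal_sum enn2ereal_ennreal less_imp_le)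
  ultimately show ?thesis
    by (simp only: *)
qed

context ordered_sample
begin

definition loss_at :: "(real \<Rightarrow> real) \<Rightarrow> nat \<Rightarrow> ereal" where
  "loss_at g i = enn2ereal (cum_hazard g (x i)) - (if i = n then 0 else elog (g (x i)))"

text \<open>
  A cumulative hazard is nonnegative, and the logarithm never reaches \<open>+\<infinity>\<close>. So \<open>phi\<close> is an
  honest sum with values in \<open>(-\<infinity>, \<infinity>]\<close>.
\<close>

lemma loss_at_neq_MInf: "loss_at g i \<noteq> - \<infinity>"
proof -
  have "enn2ereal (cum_hazard g (x i)) \<noteq> - \<infinity>"
    using enn2ereal_nonneg[of "cum_hazard g (x i)"] by auto
  then show ?thesis
    by (cases "enn2ereal (cum_hazard g (x i))") (auto simp: loss_at_def elog_def)
qed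

lemma phi_eq_sum: "phi n X g = ereal (1 / real n) * (\<Sum>i\<in>{1..n}. loss_at g i)"
proof -
  let ?f = "\<lambda>t. enn2ereal (cum_hazard g t) - (if t \<noteq> b then elog (g t) else 0)"
  have f: "?f (x i) = loss_at g i" if "i \<in> {1..n}" for i
    using that x_less_b[of i] by (cases "i = n") (auto simp: loss_at_def)
  have "(\<Sum>i\<in>{1..n}. F (?f (x i)) * indicator {0..} (x i)) = (\<Sum>i\<in>{1..n}. F (loss_at g i))"
    for F :: "ereal \<Rightarrow> ennreal"
    using x_pos by (intro sum.cong refl) (simp only: f, simp add: less_imp_le)
  from this[of "\<lambda>u. e2ennreal (- u)"] this[of e2ennreal] show ?thesis
    unfolding phi_def ereal_integral_def nn_integral_emp_measure
    using n_pos by (simp only: ereal_pos_minus_neg_part_sum[OF _ loss_at_neq_MInf] finite_atLeastAtMost zero_less_divide_1_iff)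
qed

section \<open>The measure with the empirical survival function as density\<close>

lemma emp_surv_eq: "emp_surv n X s = 1 / real n * (\<Sum>i\<in>{1..n}. indicator {..<x i} s)"
proof -
  have "(\<Sum>i\<in>{1..n}. indicator {..<x i} s) = (\<Sum>i\<in>{1..n}. 1 - indicator {x i..} s :: real)"
    by (intro sum.cong) (auto simp: indicator_def)
  also have "\<dots> = real n - (\<Sum>i\<in>{1..n}. indicator {x i..} s)"
    by (simp add: sum_subtractf)
  finally show ?thesis
    using n_pos by (simp add: emp_surv_def emp_df_jumps diff_divide_distrib)
qed

lemma emp_surv_nonneg: "0 \<le> emp_surv n X s"
  by (simp add: emp_surv_eq sum_nonneg)

lemma emp_surv_le_1: "emp_surv n X s \<le> 1"
  by (simp add: emp_surv_def emp_df_def sum_nonneg)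

lemma emp_surv_measurable [measurable]: "emp_surv n X \<in> borel_measurable borel"
  unfolding emp_surv_eq[abs_def] by measurable

lemma emp_surv_beyond: "emp_surv n X s = 0" if "b \<le> s"
proof -
  have "(\<Sum>i\<in>{1..n}. indicator {..<x i} s) = (\<Sum>i\<in>{1..n}. 0::real)"
    using that x_le_b by (intro sum.cong) (force simp: indicator_def)+
  then show ?thesis by (simp add: emp_surv_eq)
qed

text \<open>
  Integration against this measure evaluates \<open>\<integral>P d\<F>\<^sub>n\<close> for the primitive \<open>P\<close> of the integrand; see
  \<open>nn_integral_surv_measure_eq_sum\<close>.
\<close>

definition surv_measure :: "real measure" where
  "surv_measure = density lborel (\<lambda>s. ennreal (emp_surv n X s) * indicator {0..} s)"

lemma sets_surv_measure [simp, measurable_cong]: "sets surv_measure = sets borel"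
  by (simp add: surv_measure_def)

lemma space_surv_measure [simp]: "space surv_measure = UNIV"
  by (simp add: surv_measure_def)

lemma nn_integral_surv_measure:
  assumes [measurable]: "f \<in> borel_measurable borel"
  shows "(\<integral>\<^sup>+ s. f s \<partial>surv_measure) = (\<integral>\<^sup>+ s\<in>{0..}. ennreal (emp_surv n X s) * f s \<partial>lborel)"
  unfolding surv_measure_def by (subst nn_integral_density) (auto intro!: nn_integral_cong simp: mult_ac)

text \<open>
  The survival function is the average of the indicators of \<open>[0, x i)\<close>, and closing these
  intervals adds a null set.
\<close>

lemma nn_integral_surv_measure_eq_sum:
  assumes [measurable]: "f \<in> borel_measurable borel"
  shows "(\<integral>\<^sup>+ s. f s \<partial>surv_measure) = ennreal (1 / real n) * (\<Sum>i\<in>{1..n}. \<integral>\<^sup>+ s\<in>{0..x i}. f s \<partial>lborel)"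
proof -
  have S: "ennreal (emp_surv n X s) = ennreal (1 / real n) * (\<Sum>i\<in>{1..n}. indicator {..<x i} s)" for s
    unfolding emp_surv_eq
    by (subst ennreal_mult) (auto simp: sum_nonneg ennreal_indicator sum_ennreal[symmetric] simp del: sum_ennreal)
  have "(\<integral>\<^sup>+ s. f s \<partial>surv_measure) =
      (\<integral>\<^sup>+ s. ennreal (1 / real n) * (\<Sum>i\<in>{1..n}. f s * indicator {0..<x i} s) \<partial>lborel)"
    unfolding nn_integral_surv_measure[OF assms] S
    by (intro nn_integral_cong)
      (auto simp: mult.assoc sum_distrib_right intro!: sum.cong arg_cong2[of _ _ _ _ "(*)"] split: split_indicator)
  also have "\<dots> = ennreal (1 / real n) * (\<Sum>i\<in>{1..n}. \<integral>\<^sup>+ s\<in>{0..<x i}. f s \<partial>lborel)"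
    by (subst nn_integral_cmult, measurable, subst nn_integral_sum) auto
  moreover have "(\<integral>\<^sup>+ s\<in>{0..<x i}. f s \<partial>lborel) = (\<integral>\<^sup>+ s\<in>{0..x i}. f s \<partial>lborel)" for i
    by (rule nn_integral_cong_AE, rule AE_mp[OF AE_lborel_singleton[of "x i"]]) (auto split: split_indicator)
  ultimately show ?thesis by simp
qed

lemma AE_surv_measure: "AE s in surv_measure. 0 \<le> s \<and> s < b"
proof -
  have "0 \<le> s \<and> s < b" if "0 < ennreal (emp_surv n X s) * indicator {0..} s" for s
    using that emp_surv_beyond[of s] by (cases "s < b") (auto split: split_indicator_asm)
  then have "AE s in lborel. 0 < ennreal (emp_surv n X s) * indicator {0..} s \<longrightarrow> 0 \<le> s \<and> s < b"
    by blast
  then show ?thesis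
    unfolding surv_measure_def by (subst AE_density) measurable
qed

lemma nn_integral_surv_measure_bounded_finite:
  assumes [measurable]: "f \<in> borel_measurable borel" and "0 \<le> C" "\<And>s. 0 \<le> s \<Longrightarrow> s \<le> b \<Longrightarrow> f s \<le> ennreal C"
  shows "(\<integral>\<^sup>+ s. f s \<partial>surv_measure) \<le> ennreal (C * b)"
proof -
  have "(\<integral>\<^sup>+ s. f s \<partial>surv_measure) = (\<integral>\<^sup>+ s\<in>{0..}. ennreal (emp_surv n X s) * f s \<partial>lborel)"
    by (rule nn_integral_surv_measure) fact
  also have "\<dots> \<le> (\<integral>\<^sup>+ s. ennreal C * indicator {0..b} s \<partial>lborel)"
  proof (intro nn_integral_mono)
    fix s
    show "ennreal (emp_surv n X s) * f s * indicator {0..} s \<le> ennreal C * indicator {0..b} s"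
    proof (cases "0 \<le> s \<and> s \<le> b")
      case True
      then have "ennreal (emp_surv n X s) * f s \<le> 1 * ennreal C"
        using emp_surv_le_1[of s] assms(3)[of s] by (intro mult_mono) auto
      then show ?thesis using True by simp
    qed (auto simp: emp_surv_beyond)
  qed
  also have "\<dots> = ennreal (C * b)"
    using b_pos \<open>0 \<le> C\<close> by (simp add: nn_integral_cmult ennreal_mult)
  finally show ?thesis .
qed

lemma finite_surv_measure: "finite_measure surv_measure"
proof
  show "emeasure surv_measure (space surv_measure) \<noteq> \<infinity>"
    using nn_integral_surv_measure_bounded_finite[of "\<lambda>_. 1" 1] by (auto simp: top_unique)
qed

lemma integrable_surv_measure:
  fixes f :: "real \<Rightarrow> real"
  assumes "f \<in> borel_measurable borel" and "\<And>s. 0 \<le> s \<Longrightarrow> s \<le> b \<Longrightarrow> \<bar>f s\<bar> \<le> B"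
  shows "integrable surv_measure f"
proof (rule finite_measure.integrable_const_bound[OF finite_surv_measure])
  show "AE s in surv_measure. norm (f s) \<le> B"
    using AE_surv_measure by eventually_elim (use assms(2) in auto)
  show "f \<in> borel_measurable surv_measure"
    using assms(1) by (simp add: measurable_cong_sets[OF sets_surv_measure refl])
qed

lemma integrable_surv_measure_continuous:
  fixes f :: "real \<Rightarrow> real"
  assumes "continuous_on UNIV f"
  shows "integrable surv_measure f"
proof -
  have "bounded (f ` {0..b})"
    by (intro compact_imp_bounded compact_continuous_image continuous_on_subset[OF assms]) auto
  then obtain B where "\<And>s. s \<in> {0..b} \<Longrightarrow> \<bar>f s\<bar> \<le> B"
    unfolding bounded_iff by (metis imageI real_norm_def)
  then show ?thesis
    by (intro integrable_surv_measure[of _ B] borel_measurable_continuous_onI assms) auto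
qed

end

section \<open>Hinge minorants of convex functions\<close>

text \<open>
  The points of \<open>A\<close> are visited from left to right, and the minorant is kept affine to the right of the
  last point visited. If it is still too small at the next point \<open>z\<close>, a hinge is added that starts where
  this affine piece meets the supporting line at \<open>z\<close> and bends the minorant onto that line. The
  meeting point cannot lie to the left of an earlier point \<open>y\<close>, since the line at \<open>z\<close> stays below
  \<open>g\<close> at \<open>y\<close>; hence the values at earlier points are kept. The predicate \<open>Q\<close> stands for any
  property that is inherited when a hinge is added, so that no explicit list of hinges is needed.
\<close>

lemma nondecreasing_hinge_minorant:
  fixes g s :: "real \<Rightarrow> real"
  assumes A: "finite A" "A \<subseteq> U"
    and sub: "\<And>y t. y \<in> A \<Longrightarrow> t \<in> U \<Longrightarrow> g y + s y * (t - y) \<le> g t"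
    and s: "\<And>y. y \<in> A \<Longrightarrow> 0 \<le> s y"
    and lower: "\<And>t. t \<in> U \<Longrightarrow> a \<le> g t"
    and greatest: "\<And>c. (\<And>t. t \<in> U \<Longrightarrow> c \<le> g t) \<Longrightarrow> c \<le> a"
    and Q0: "Q (\<lambda>_. 0)"
    and Q_add: "\<And>R w c. Q R \<Longrightarrow> 0 \<le> w \<Longrightarrow> Q (\<lambda>t. R t + w * max (t - c) 0)"
  shows "\<exists>R. Q R \<and> mono R \<and> (\<forall>t. 0 \<le> R t) \<and> (\<forall>t\<in>U. a + R t \<le> g t) \<and> (\<forall>y\<in>A. a + R y = g y)"
proof -
  \<comment> \<open>The last clause gives the initial line, of slope zero at the height of the infimum.\<close>
  define good where "good B R \<alpha> \<sigma> \<longleftrightarrow> Q R \<and> mono R \<and> (\<forall>t. 0 \<le> R t) \<and> (\<forall>t\<in>U. a + R t \<le> g t) \<and>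
      (\<forall>y\<in>B. a + R y = g y) \<and> (\<forall>t. (\<forall>y\<in>B. y \<le> t) \<longrightarrow> a + R t = \<alpha> + \<sigma> * t) \<and>
      (B = {} \<longrightarrow> \<alpha> = a \<and> \<sigma> = 0)" for B R \<alpha> \<sigma>
  have "\<exists>R \<alpha> \<sigma>. good B R \<alpha> \<sigma>"
    if "finite B" "B \<subseteq> A" for B
    using that
  proof (induction B rule: finite_linorder_max_induct)
    case empty
    show ?case
      using Q0 lower by (intro exI[of _ "\<lambda>_. 0"] exI[of _ a] exI[of _ 0]) (auto simp: good_def mono_def)
  next
    case (insert z B)
    have "B \<subseteq> A" using insert.prems by simp
    from insert.IH[OF this] obtain R \<alpha> \<sigma> where IH: "good B R \<alpha> \<sigma>"
      by blast
    have R: "Q R" "mono R" "\<And>t. 0 \<le> R t" "\<And>t. t \<in> U \<Longrightarrow> a + R t \<le> g t"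
        "\<And>y. y \<in> B \<Longrightarrow> a + R y = g y"
      and line: "\<And>t. (\<And>y. y \<in> B \<Longrightarrow> y \<le> t) \<Longrightarrow> a + R t = \<alpha> + \<sigma> * t"
      and empty: "B = {} \<Longrightarrow> \<alpha> = a \<and> \<sigma> = 0"
      using IH by (simp_all add: good_def)
    have z: "z \<in> A" "z \<in> U" and less: "\<And>y. y \<in> B \<Longrightarrow> y < z"
      using insert A by auto
    \<comment> \<open>the height by which the current minorant misses \<open>g\<close> at \<open>z\<close>\<close>
    define D where "D = g z - (a + R z)"
    have D: "D = g z - (\<alpha> + \<sigma> * z)"
      using line[of z] less by (force simp: D_def)
    show ?case
    proof (cases "D = 0")
      case True
      then show ?thesis
        using R line empty by (intro exI[of _ R] exI[of _ \<alpha>] exI[of _ \<sigma>]) (auto simp: good_def D_def)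
    next
      case False
      with R(4)[OF z(2)] have "0 < D" by (simp add: D_def)
      define w where "w = s z - \<sigma>"
      have D_le: "D \<le> w * (z - y)" if "y \<in> B" for y
      proof -
        define m where "m = Max B"
        have m: "m \<in> B" "y \<le> m"
          unfolding m_def using that insert.hyps by (force intro: Max_in, auto)
        have "g m = \<alpha> + \<sigma> * m"
          using R(5)[OF m(1)] line[of m] insert by (auto simp: m_def)
        moreover have "g z + s z * (m - z) \<le> g m"
          using sub[OF z(1), of m] m insert A by auto
        ultimately have Dm: "D \<le> w * (z - m)"
          by (simp add: D w_def algebra_simps)
        then have "0 \<le> w"
          using less[OF m(1)] \<open>0 < D\<close> by (smt (verit) mult_nonpos_nonneg)
        then have "w * (z - m) \<le> w * (z - y)"
          using m by (intro mult_left_mono) auto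
        with Dm show ?thesis by simp
      qed
      have "0 < w"
      proof (cases "B = {}")
        case True
        have "s z \<noteq> 0"
        proof
          assume "s z = 0"
          then have "g z \<le> a"
            using sub[OF z(1)] by (intro greatest) auto
          then show False using True empty \<open>0 < D\<close> by (auto simp: D)
        qed
        then show ?thesis using True empty s[OF z(1)] by (auto simp: w_def)
      next
        case False
        then obtain y where "y \<in> B" by auto
        then show ?thesis
          using D_le[of y] less[of y] \<open>0 < D\<close> by (smt (verit) mult_nonpos_nonneg)
      qed
      \<comment> \<open>the abscissa where the current line meets the supporting line at \<open>z\<close>\<close>
      define c where "c = z - D / w"
      have wc: "w * (z - c) = D" and "c < z"
        using \<open>0 < w\<close> \<open>0 < D\<close> by (auto simp: c_def field_simps)
      have c: "y \<le> c" if "y \<in> B" for y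
        using D_le[OF that] \<open>0 < w\<close> by (simp add: c_def field_simps)
      define R' where "R' t = R t + w * max (t - c) 0" for t
      have left: "R' t = R t" if "t \<le> c" for t
        using that by (simp add: R'_def)
      have right: "a + R' t = g z + s z * (t - z)" if "c \<le> t" for t
      proof -
        have "a + R t = \<alpha> + \<sigma> * t"
          using that c by (intro line) force
        then have "a + R' t = \<alpha> + \<sigma> * t + w * (z - c) + w * (t - z)"
          using that by (simp add: R'_def algebra_simps)
        also have "\<dots> = g z + s z * (t - z)"
          by (simp only: wc) (simp add: D w_def algebra_simps)
        finally show ?thesis .
      qed
      have "Q R'"
        unfolding R'_def[abs_def] using R(1) \<open>0 < w\<close> by (intro Q_add) auto
      moreover have "mono R'"
        using R(2) \<open>0 < w\<close> unfolding R'_def[abs_def] mono_def by (auto intro!: add_mono mult_left_mono)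
      moreover have "0 \<le> R' t" for t
        using R(3) \<open>0 < w\<close> by (simp add: R'_def)
      moreover have "a + R' t \<le> g t" if "t \<in> U" for t
        using left right R(4)[OF that] sub[OF z(1) that] by (cases "t \<le> c") auto
      moreover have "a + R' y = g y" if "y \<in> insert z B" for y
        using that left c R(5) right \<open>c < z\<close> by auto
      moreover have "a + R' t = (g z - s z * z) + s z * t" if "\<And>y. y \<in> insert z B \<Longrightarrow> y \<le> t" for t
        using right[of t] that[of z] \<open>c < z\<close> by (simp add: algebra_simps)
      ultimately have "good (insert z B) R' (g z - s z * z) (s z)"
        unfolding good_def by (intro conjI allI ballI impI) (assumption | blast)+
      then show ?thesis by blast
    qed
  qed
  from this[OF A(1) order_refl] show ?thesis by (auto simp: good_def)
qed

text \<open>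
  Points with nonnegative and with negative slope are treated separately, the latter by reflection,
  both starting from the infimum \<open>a\<close> of \<open>g\<close>. The two resulting functions \<open>R\<close> and \<open>L\<close> may be
  added because at each point one of them vanishes: if both were positive at \<open>t\<close>, then by
  monotonicity \<open>g\<close> would exceed \<open>a\<close> by a fixed amount on either side of \<open>t\<close>.
\<close>

lemma convex_hinge_minorant:
  fixes g :: "real \<Rightarrow> real"
  assumes g: "convex_on U g" and nonneg: "\<And>t. t \<in> U \<Longrightarrow> 0 \<le> g t" and "U \<noteq> {}"
    and A: "finite A" "A \<subseteq> interior U"
    and Q_const: "\<And>a. 0 \<le> a \<Longrightarrow> Q (\<lambda>_. a)"
    and Q_right: "\<And>p w c. Q p \<Longrightarrow> 0 \<le> w \<Longrightarrow> Q (\<lambda>t. p t + w * max (t - c) 0)"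
    and Q_left: "\<And>p w c. Q p \<Longrightarrow> 0 \<le> w \<Longrightarrow> Q (\<lambda>t. p t + w * max (c - t) 0)"
  shows "\<exists>p. Q p \<and> (\<forall>t\<in>U. 0 \<le> p t \<and> p t \<le> g t) \<and> (\<forall>y\<in>A. p y = g y)"
proof -
  have A_U: "A \<subseteq> U" using A(2) interior_subset by blast
  define s where "s y = Inf ((\<lambda>t. (g y - g t) / (y - t)) ` ({y<..} \<inter> U))" for y
  have sub: "g y + s y * (t - y) \<le> g t" if "y \<in> A" "t \<in> U" for y t
    using convex_le_Inf_differential[OF g] that A(2) by (auto simp: s_def)
  define a where "a = (INF t\<in>U. g t)"
  have bdd: "bdd_below (g ` U)" using nonneg by (auto intro!: bdd_belowI)
  have lower: "a \<le> g t" if "t \<in> U" for t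
    unfolding a_def using that bdd by (rule cINF_lower[rotated])
  have greatest: "c \<le> a" if "\<And>t. t \<in> U \<Longrightarrow> c \<le> g t" for c
    unfolding a_def using \<open>U \<noteq> {}\<close> that by (intro cINF_greatest) auto
  have "0 \<le> a" using nonneg by (intro greatest)
  have "\<exists>R. Q (\<lambda>t. a + R t) \<and> mono R \<and> (\<forall>t. 0 \<le> R t) \<and> (\<forall>t\<in>U. a + R t \<le> g t) \<and>
      (\<forall>y\<in>{y\<in>A. 0 \<le> s y}. a + R y = g y)"
  proof (rule nondecreasing_hinge_minorant[where s = s])
    show "Q (\<lambda>t. a + (R t + w * max (t - c) 0))" if "Q (\<lambda>t. a + R t)" "0 \<le> w" for R w c
      using Q_right[OF that, of c] by (simp add: add.assoc)
  qed (use A A_U sub lower greatest Q_const[OF \<open>0 \<le> a\<close>] in auto)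
  then obtain R where R: "Q (\<lambda>t. a + R t)" "mono R" "\<And>t. 0 \<le> R t" "\<And>t. t \<in> U \<Longrightarrow> a + R t \<le> g t"
      "\<And>y. y \<in> A \<Longrightarrow> 0 \<le> s y \<Longrightarrow> a + R y = g y"
    by auto
  have "\<exists>L. Q (\<lambda>t. a + R t + L (- t)) \<and> mono L \<and> (\<forall>t. 0 \<le> L t) \<and> (\<forall>t\<in>uminus ` U. a + L t \<le> g (- t)) \<and>
      (\<forall>y\<in>uminus ` {y\<in>A. s y < 0}. a + L y = g (- y))"
  proof (rule nondecreasing_hinge_minorant[where s = "\<lambda>y. - s (- y)"])
    show "Q (\<lambda>t. a + R t + (L (- t) + w * max (- t - c) 0))" if "Q (\<lambda>t. a + R t + L (- t))" "0 \<le> w" for L w c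
      using Q_left[OF that, of "- c"] by (simp add: add.assoc minus_diff_commute)
    show "c \<le> a" if "\<And>t. t \<in> uminus ` U \<Longrightarrow> c \<le> g (- t)" for c
      using that by (intro greatest) force
    show "g (- y) + - s (- y) * (t - y) \<le> g (- t)"
      if "y \<in> uminus ` {y \<in> A. s y < 0}" "t \<in> uminus ` U" for y t
      using that sub by (auto simp: algebra_simps)
  qed (use A A_U sub lower R(1) in auto)
  then obtain L where L: "Q (\<lambda>t. a + R t + L (- t))" "mono L" "\<And>t. 0 \<le> L t"
      "\<And>t. t \<in> U \<Longrightarrow> a + L (- t) \<le> g t" "\<And>y. y \<in> A \<Longrightarrow> s y < 0 \<Longrightarrow> a + L (- y) = g y"
    by force
  \<comment> \<open>Otherwise \<open>a\<close> would not be the infimum of \<open>g\<close>.\<close>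
  have disjoint: "R t = 0 \<or> L (- t) = 0" if "t \<in> U" for t
  proof (rule ccontr)
    assume "\<not> ?thesis"
    then have pos: "0 < min (R t) (L (- t))"
      using R(3)[of t] L(3)[of "- t"] by auto
    have "a + min (R t) (L (- t)) \<le> g u" if "u \<in> U" for u
      using R(4)[OF that] L(4)[OF that] monoD[OF R(2), of t u] monoD[OF L(2), of "- t" "- u"]
      by (cases "t \<le> u") auto
    from greatest[OF this] pos show False by simp
  qed
  show ?thesis
  proof (intro exI conjI ballI)
    show "Q (\<lambda>t. a + R t + L (- t))" by fact
    show upper: "a + R t + L (- t) \<le> g t" if "t \<in> U" for t
      using disjoint[OF that] R(4)[OF that] L(4)[OF that] by auto
    show "0 \<le> a + R t + L (- t)" for t
      using \<open>0 \<le> a\<close> R(3) L(3) by simp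
    show "a + R y + L (- y) = g y" if "y \<in> A" for y
      using upper[of y] R(3)[of y] L(3)[of "- y"] R(5)[OF that] L(5)[OF that] that A_U
      by (cases "0 \<le> s y") auto
  qed
qed

context ordered_sample
begin

section \<open>The criterion function on continuous hazards\<close>

text \<open>
  Only the integrals of \<open>g\<close> and its values at \<open>x 1, \<dots>, x (n - 1)\<close> enter \<open>phi\<close>. At the endpoint \<open>b\<close>,
  where \<open>p\<close> and \<open>g\<close> are unrelated, the integrals see a null set.
\<close>

lemma phi_mono:
  assumes le: "\<And>t. 0 \<le> t \<Longrightarrow> t < b \<Longrightarrow> p t \<le> g t"
    and eq: "\<And>i. i \<in> {1..<n} \<Longrightarrow> p (x i) = g (x i)"
  shows "phi n X p \<le> phi n X g"
proof -
  have cum: "cum_hazard p (x i) \<le> cum_hazard g (x i)" if "i \<in> {1..n}" for i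
    unfolding cum_hazard_def
  proof (rule nn_integral_mono_AE, rule AE_mp[OF AE_lborel_singleton[of b]], rule AE_I2, rule impI)
    fix s assume "s \<noteq> b"
    then show "ennreal (p s) * indicator {0..x i} s \<le> ennreal (g s) * indicator {0..x i} s"
      using x_le_b[OF that] le[of s] by (auto split: split_indicator intro: ennreal_leI)
  qed
  have "loss_at p i \<le> loss_at g i" if "i \<in> {1..n}" for i
    using cum[OF that] eq[of i] that unfolding loss_at_def
    by (intro ereal_minus_mono) (auto simp: less_eq_ennreal.rep_eq)
  then show ?thesis
    unfolding phi_eq_sum by (intro ereal_mult_left_mono sum_mono) auto
qed

lemma phi_cong:
  assumes "\<And>t. 0 \<le> t \<Longrightarrow> t < b \<Longrightarrow> p t = g t"
  shows "phi n X p = phi n X g"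
  using assms x_pos x_less_b by (intro antisym phi_mono) (auto simp: less_imp_le)

lemma phi_infinite:
  assumes "i \<in> {1..<n}" "g (x i) \<le> 0"
  shows "phi n X g = \<infinity>"
proof -
  have "loss_at g i = \<infinity>"
    using assms enn2ereal_nonneg[of "cum_hazard g (x i)"]
    by (cases "enn2ereal (cum_hazard g (x i))") (auto simp: loss_at_def elog_def)
  moreover have "i \<in> {1..n}" using assms by auto
  ultimately have "(\<Sum>i\<in>{1..n}. loss_at g i) = \<infinity>"
    by (subst sum_Pinfty) auto
  then show ?thesis
    using n_pos by (simp add: phi_eq_sum)
qed

text \<open>
  This is \<open>\<integral>P d\<F>\<^sub>n\<close> with \<open>P t = \<integral>\<^sub>0\<^sup>t p(s) ds\<close>, by \<open>sum_cum_hazard\<close>.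
\<close>

definition expected_cum :: "(real \<Rightarrow> real) \<Rightarrow> real" where
  "expected_cum p = (\<integral>s. p s \<partial>surv_measure)"

lemma nn_integral_surv_measure_real:
  assumes "integrable surv_measure p" "\<And>t. 0 \<le> t \<Longrightarrow> t < b \<Longrightarrow> 0 \<le> p t"
  shows "(\<integral>\<^sup>+ s. ennreal (p s) \<partial>surv_measure) = ennreal (expected_cum p)" "0 \<le> expected_cum p"
proof -
  have "AE s in surv_measure. 0 \<le> p s"
    using AE_surv_measure by eventually_elim (use assms(2) in auto)
  then show "(\<integral>\<^sup>+ s. ennreal (p s) \<partial>surv_measure) = ennreal (expected_cum p)" "0 \<le> expected_cum p"
    unfolding expected_cum_def using assms(1)
    by (auto intro: nn_integral_eq_integral integral_nonneg_AE)
qed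

lemma sum_cum_hazard:
  assumes p: "continuous_on UNIV p" and nonneg: "\<And>t. 0 \<le> t \<Longrightarrow> t < b \<Longrightarrow> 0 \<le> p t"
  shows "ennreal (1 / real n) * (\<Sum>i\<in>{1..n}. cum_hazard p (x i)) = ennreal (expected_cum p)"
proof -
  have [measurable]: "p \<in> borel_measurable borel"
    using p by (rule borel_measurable_continuous_onI)
  show ?thesis
    using nn_integral_surv_measure_real(1)[OF integrable_surv_measure_continuous[OF p] nonneg]
    by (simp add: cum_hazard_def nn_integral_surv_measure_eq_sum)
qed

lemma phi_continuous:
  assumes p: "continuous_on UNIV p" and nonneg: "\<And>t. 0 \<le> t \<Longrightarrow> t < b \<Longrightarrow> 0 \<le> p t"
    and pos: "\<And>i. i \<in> {1..<n} \<Longrightarrow> 0 < p (x i)"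
  shows "phi n X p = ereal (expected_cum p - 1 / real n * (\<Sum>i\<in>{1..<n}. ln (p (x i))))"
proof -
  define C where "C i = enn2real (cum_hazard p (x i))" for i
  have sum_eq: "ennreal (1 / real n) * (\<Sum>i\<in>{1..n}. cum_hazard p (x i)) = ennreal (expected_cum p)"
    using p nonneg by (rule sum_cum_hazard)
  have "0 \<le> expected_cum p"
    by (rule nn_integral_surv_measure_real(2)[OF integrable_surv_measure_continuous[OF p] nonneg])
  have "(\<Sum>i\<in>{1..n}. cum_hazard p (x i)) \<noteq> top"
  proof
    assume "(\<Sum>i\<in>{1..n}. cum_hazard p (x i)) = top"
    then have "ennreal (1 / real n) * top = ennreal (expected_cum p)"
      using sum_eq by (simp only:)
    then show False using n_pos by (simp add: ennreal_mult_top)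
  qed
  then have C: "cum_hazard p (x i) = ennreal (C i)" if "i \<in> {1..n}" for i
    using that by (simp add: C_def less_top)
  have C_nonneg: "0 \<le> C i" for i
    by (simp add: C_def)
  have "(\<Sum>i\<in>{1..n}. cum_hazard p (x i)) = ennreal (\<Sum>i\<in>{1..n}. C i)"
    by (simp add: C C_nonneg)
  then have "ennreal (1 / real n * (\<Sum>i\<in>{1..n}. C i)) = ennreal (expected_cum p)"
    using sum_eq by (simp only: ennreal_mult C_nonneg sum_nonneg zero_le_divide_1_iff of_nat_0_le_iff)
  then have E: "expected_cum p = 1 / real n * (\<Sum>i\<in>{1..n}. C i)"
    using \<open>0 \<le> expected_cum p\<close> by (simp add: sum_nonneg C_nonneg)
  have "loss_at p i = ereal (C i - (if i = n then 0 else ln (p (x i))))" if "i \<in> {1..n}" for i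
    using that C[OF that] C_nonneg pos[of i] by (cases "i = n") (auto simp: loss_at_def elog_def)
  then have "phi n X p = ereal (1 / real n * (\<Sum>i\<in>{1..n}. C i - (if i = n then 0 else ln (p (x i)))))"
    by (simp add: phi_eq_sum)
  also have "(\<Sum>i\<in>{1..n}. C i - (if i = n then 0 else ln (p (x i)))) =
      (\<Sum>i\<in>{1..n}. C i) - (\<Sum>i\<in>{1..n}. if i = n then 0 else ln (p (x i)))"
    by (rule sum_subtractf)
  also have "(\<Sum>i\<in>{1..n}. if i = n then 0 else ln (p (x i))) = (\<Sum>i\<in>{1..<n}. ln (p (x i)))"
    using n_pos by (subst atLeastLessThanSuc_atLeastAtMost[symmetric]) (simp add: sum.atLeastLessThan_Suc)
  finally show ?thesis
    by (simp add: E right_diff_distrib)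
qed

section \<open>Directional derivatives and optimality\<close>

text \<open>
  The right derivative at \<open>\<epsilon> = 0\<close> of \<open>phi n X (\<lambda>t. h t + \<epsilon> * p t)\<close>, when \<open>h\<close> and \<open>p\<close> are continuous,
  \<open>h\<close> is positive at the first \<open>n - 1\<close> sample points and the perturbed hazards lie in \<open>K_plus n X\<close>.
\<close>

definition dir_deriv :: "(real \<Rightarrow> real) \<Rightarrow> (real \<Rightarrow> real) \<Rightarrow> real" where
  "dir_deriv h p = expected_cum p - 1 / real n * (\<Sum>i\<in>{1..<n}. p (x i) / h (x i))"

lemma dir_deriv_add:
  assumes "integrable surv_measure p" "integrable surv_measure q"
  shows "dir_deriv h (\<lambda>t. p t + q t) = dir_deriv h p + dir_deriv h q"
  using assms by (simp add: dir_deriv_def expected_cum_def sum.distrib add_divide_distrib algebra_simps)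

lemma dir_deriv_cmult: "dir_deriv h (\<lambda>t. c * p t) = c * dir_deriv h p"
  by (simp add: dir_deriv_def expected_cum_def sum_distrib_left algebra_simps)

lemma dir_deriv_sum:
  assumes "\<And>j. j \<in> J \<Longrightarrow> integrable surv_measure (p j)"
  shows "dir_deriv h (\<lambda>t. \<Sum>j\<in>J. p j t) = (\<Sum>j\<in>J. dir_deriv h (p j))"
proof -
  have "(\<Sum>i\<in>{1..<n}. (\<Sum>j\<in>J. p j (x i)) / h (x i)) = (\<Sum>j\<in>J. \<Sum>i\<in>{1..<n}. p j (x i) / h (x i))"
    unfolding sum_divide_distrib by (rule sum.swap)
  then show ?thesis
    using assms by (simp add: dir_deriv_def expected_cum_def sum_subtractf sum_divide_distrib)
qed

lemma dir_deriv_cong: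
  assumes "\<And>t. 0 \<le> t \<Longrightarrow> t < b \<Longrightarrow> p t = q t"
    and "p \<in> borel_measurable borel" "q \<in> borel_measurable borel"
  shows "dir_deriv h p = dir_deriv h q"
proof -
  have "expected_cum p = expected_cum q"
    unfolding expected_cum_def
  proof (rule integral_cong_AE)
    show "AE t in surv_measure. p t = q t"
      using AE_surv_measure by eventually_elim (use assms(1) in auto)
  qed (use assms(2,3) in \<open>auto simp: measurable_cong_sets[OF sets_surv_measure refl]\<close>)
  moreover have "(\<Sum>i\<in>{1..<n}. p (x i) / h (x i)) = (\<Sum>i\<in>{1..<n}. q (x i) / h (x i))"
    using x_pos x_less_b by (intro sum.cong) (auto simp: assms(1) less_imp_le)
  ultimately show ?thesis by (simp add: dir_deriv_def)
qed

lemma dir_deriv_self: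
  assumes "\<And>i. i \<in> {1..<n} \<Longrightarrow> 0 < h (x i)"
  shows "dir_deriv h h = expected_cum h - (1 - 1 / real n)"
proof -
  have "(\<Sum>i\<in>{1..<n}. h (x i) / h (x i)) = (\<Sum>i\<in>{1..<n}. 1)"
    using assms by (intro sum.cong) (auto simp: less_imp_neq[symmetric])
  then show ?thesis using n_pos by (simp add: dir_deriv_def field_simps of_nat_diff)
qed

lemma K_plus_cong:
  assumes "\<And>t. 0 \<le> t \<Longrightarrow> t < b \<Longrightarrow> p t = g t"
  shows "p \<in> K_plus n X \<longleftrightarrow> g \<in> K_plus n X"
proof -
  have "convex_on {0..<b} f \<longleftrightarrow> convex_on {0..<b} f'" if eq: "\<And>t. 0 \<le> t \<Longrightarrow> t < b \<Longrightarrow> f t = f' t" for f f' :: "real \<Rightarrow> real"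
  proof -
    have "f (u * s + v * t) = f' (u * s + v * t)"
      if "s \<in> {0..<b}" "t \<in> {0..<b}" "0 \<le> u" "0 \<le> v" "u + v = 1" for s t u v
      using convexD[of "{0..<b}" s t u v] that eq by auto
    then show ?thesis
      using eq by (auto simp: convex_on_def)
  qed
  from this[OF assms] show ?thesis
    using assms by (auto simp: K_plus_def)
qed

text \<open>
  A zero at one of the first \<open>n - 1\<close> sample points makes \<open>phi\<close> infinite, whereas it is finite at the
  constant hazard \<open>1\<close>.
\<close>

lemma minimizer_positive:
  assumes "minimizes_phi n X h" "i \<in> {1..<n}"
  shows "0 < h (x i)"
proof (rule ccontr)
  assume "\<not> 0 < h (x i)"
  then have "phi n X h = \<infinity>" using phi_infinite[of i h] assms by simp
  moreover have "phi n X (\<lambda>_. 1) < \<infinity>" by (subst phi_continuous) auto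
  moreover have "(\<lambda>_. 1) \<in> K_plus n X" by (auto simp: K_plus_def convex_on_const)
  ultimately show False using assms by (auto simp: minimizes_phi_def is_arg_min_def)
qed

lemma dir_deriv_nonneg_of_minimizer:
  assumes min: "minimizes_phi n X h"
    and h: "continuous_on UNIV h" and p: "continuous_on UNIV p"
    and "0 < r" and K: "\<And>\<epsilon>. 0 < \<epsilon> \<Longrightarrow> \<epsilon> < r \<Longrightarrow> (\<lambda>t. h t + \<epsilon> * p t) \<in> K_plus n X"
  shows "0 \<le> dir_deriv h p"
proof (rule ccontr)
  assume neg: "\<not> 0 \<le> dir_deriv h p"
  have pos: "0 < h (x i)" if "i \<in> {1..<n}" for i
    using minimizer_positive[OF min that] .
  \<comment> \<open>the increment of \<open>phi\<close> along the segment from \<open>h\<close> in the direction \<open>p\<close>, up to a constant\<close>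
  define \<theta> where "\<theta> \<epsilon> = \<epsilon> * expected_cum p - 1 / real n * (\<Sum>i\<in>{1..<n}. ln (h (x i) + \<epsilon> * p (x i)))" for \<epsilon>
  have "(\<theta> has_real_derivative dir_deriv h p) (at 0)"
    unfolding \<theta>_def dir_deriv_def
    by (auto intro!: derivative_eq_intros pos simp: pos less_imp_neq[symmetric] divide_inverse mult.commute)
  from DERIV_neg_dec_right[OF this] neg obtain d where d: "0 < d" "\<And>\<epsilon>. 0 < \<epsilon> \<Longrightarrow> \<epsilon> < d \<Longrightarrow> \<theta> \<epsilon> < \<theta> 0"
    by auto
  have "\<forall>\<^sub>F \<epsilon> in at_right 0. \<forall>i\<in>{1..<n}. 0 < h (x i) + \<epsilon> * p (x i)"
  proof (intro eventually_ball_finite ballI)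
    fix i assume "i \<in> {1..<n}"
    have "((\<lambda>\<epsilon>. h (x i) + \<epsilon> * p (x i)) \<longlongrightarrow> h (x i) + 0 * p (x i)) (at_right 0)"
      by (intro tendsto_intros)
    then show "\<forall>\<^sub>F \<epsilon> in at_right 0. 0 < h (x i) + \<epsilon> * p (x i)"
      using pos[OF \<open>i \<in> _\<close>] by (intro order_tendstoD) auto
  qed auto
  moreover have "\<forall>\<^sub>F \<epsilon> in at_right 0. \<epsilon> \<in> {0<..<min d r}"
    using \<open>0 < d\<close> \<open>0 < r\<close> by (intro eventually_at_right_real) auto
  ultimately have "\<forall>\<^sub>F \<epsilon> in at_right 0. 0 < \<epsilon> \<and> \<epsilon> < min d r \<and> (\<forall>i\<in>{1..<n}. 0 < h (x i) + \<epsilon> * p (x i))"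
    by eventually_elim auto
  then obtain \<epsilon> where \<epsilon>: "0 < \<epsilon>" "\<epsilon> < d" "\<epsilon> < r" "\<And>i. i \<in> {1..<n} \<Longrightarrow> 0 < h (x i) + \<epsilon> * p (x i)"
    using eventually_happens'[OF trivial_limit_at_right_real] by (metis (mono_tags, lifting) min_less_iff_conj)
  let ?g = "\<lambda>t. h t + \<epsilon> * p t"
  have "?g \<in> K_plus n X" using \<epsilon> by (intro K)
  then have "phi n X h \<le> phi n X ?g" and nonneg: "0 \<le> ?g t" if "0 \<le> t" "t < b" for t
    using min that by (auto simp: minimizes_phi_def is_arg_min_def K_plus_def not_less)
  moreover have "phi n X ?g = ereal (expected_cum ?g - 1 / real n * (\<Sum>i\<in>{1..<n}. ln (?g (x i))))"
    using \<epsilon> nonneg by (intro phi_continuous continuous_intros h p) auto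
  moreover have "phi n X h = ereal (expected_cum h - 1 / real n * (\<Sum>i\<in>{1..<n}. ln (h (x i))))"
    using min pos by (intro phi_continuous h) (auto simp: minimizes_phi_def is_arg_min_def K_plus_def)
  moreover have "expected_cum ?g = expected_cum h + \<epsilon> * expected_cum p"
    using integrable_surv_measure_continuous[OF h] integrable_surv_measure_continuous[OF p]
    by (simp add: expected_cum_def)
  ultimately have "\<theta> 0 \<le> \<theta> \<epsilon>"
    using b_pos by (auto simp: \<theta>_def)
  with d \<epsilon> show False by force
qed

text \<open>
  A competitor \<open>g\<close> is first lowered to a hinge minorant \<open>p\<close> with the same values at the sample points.
  Then \<open>ln u \<le> u - 1\<close> with \<open>u = p (x i) / h (x i)\<close> gives
  \<open>phi p - phi h \<ge> dir_deriv h p - dir_deriv h h \<ge> 0\<close>.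
\<close>

lemma minimizer_if_dir_deriv_nonneg:
  assumes hK: "h \<in> K_plus n X" and h: "continuous_on UNIV h"
    and pos: "\<And>i. i \<in> {1..<n} \<Longrightarrow> 0 < h (x i)"
    and self: "dir_deriv h h = 0"
    and const: "0 \<le> dir_deriv h (\<lambda>_. 1)"
    and left: "\<And>c. 0 \<le> c \<Longrightarrow> 0 \<le> dir_deriv h (\<lambda>t. max (c - t) 0)"
    and right: "\<And>c. 0 \<le> c \<Longrightarrow> 0 \<le> dir_deriv h (\<lambda>t. max (t - c) 0)"
  shows "minimizes_phi n X h"
proof -
  have *: "phi n X h \<le> phi n X g" if g: "g \<in> K_plus n X" for g
  proof (cases "\<forall>i\<in>{1..<n}. 0 < g (x i)")
    case False
    then show ?thesis using phi_infinite by (auto simp: not_less)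
  next
    case g_pos: True
    have int: "integrable surv_measure p" if "continuous_on UNIV p" for p :: "real \<Rightarrow> real"
      using that by (rule integrable_surv_measure_continuous)
    let ?Q = "\<lambda>p. continuous_on UNIV p \<and> 0 \<le> dir_deriv h p"
    have Qc: "?Q (\<lambda>_. c)" if "0 \<le> c" for c
      using dir_deriv_cmult[of h c "\<lambda>_. 1"] const that by simp
    have Q_add: "?Q (\<lambda>t. p t + w * q t)" if "?Q p" "?Q q" "0 \<le> w" for p q w
      using that by (auto intro!: continuous_intros simp: dir_deriv_add int dir_deriv_cmult)
    have Q_cong: "?Q p" if "?Q q" "continuous_on UNIV p" "\<And>t. 0 \<le> t \<Longrightarrow> t < b \<Longrightarrow> p t = q t" for p q
      using dir_deriv_cong[of p q h, OF _ borel_measurable_continuous_onI borel_measurable_continuous_onI] that by auto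
    \<comment> \<open>Negative \<open>c\<close> have to be covered as well: there the hinges are zero or affine on the sample range.\<close>
    have Ql: "?Q (\<lambda>t. max (c - t) 0)" for c
    proof (cases "0 \<le> c")
      case True
      then show ?thesis using left by (auto intro!: continuous_intros)
    next
      case False
      then show ?thesis by (intro Q_cong[OF Qc[of 0]]) (auto intro!: continuous_intros)
    qed
    have Qr: "?Q (\<lambda>t. max (t - c) 0)" for c
    proof (cases "0 \<le> c")
      case True
      then show ?thesis using right by (auto intro!: continuous_intros)
    next
      case False
      have "?Q (\<lambda>t. (- c) + 1 * max (t - 0) 0)"
        using False right[of 0] by (intro Q_add Qc) (auto intro!: continuous_intros)
      then show ?thesis by (rule Q_cong) (use False in \<open>auto intro!: continuous_intros\<close>)
    qed
    have "\<exists>p. ?Q p \<and> (\<forall>t\<in>{0..<b}. 0 \<le> p t \<and> p t \<le> g t) \<and> (\<forall>y\<in>x ` {1..<n}. p y = g y)"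
    proof (rule convex_hinge_minorant)
      show "x ` {1..<n} \<subseteq> interior {0..<b}"
        using x_pos x_less_b by auto
    qed (use g b_pos Qc Q_add[OF _ Ql] Q_add[OF _ Qr] in \<open>auto simp: K_plus_def\<close>)
    then obtain p where p: "continuous_on UNIV p" "0 \<le> dir_deriv h p"
      and p_le: "\<And>t. 0 \<le> t \<Longrightarrow> t < b \<Longrightarrow> 0 \<le> p t" "\<And>t. 0 \<le> t \<Longrightarrow> t < b \<Longrightarrow> p t \<le> g t"
      and p_eq: "\<And>i. i \<in> {1..<n} \<Longrightarrow> p (x i) = g (x i)"
      by auto
    have p_pos: "0 < p (x i)" if "i \<in> {1..<n}" for i
      using that g_pos p_eq by auto
    have "ln (p (x i)) - ln (h (x i)) \<le> p (x i) / h (x i) - h (x i) / h (x i)" if "i \<in> {1..<n}" for i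
      using ln_le_minus_one[of "p (x i) / h (x i)"] p_pos[OF that] pos[OF that] by (simp add: ln_div)
    then have "(\<Sum>i\<in>{1..<n}. ln (p (x i)) - ln (h (x i))) \<le> (\<Sum>i\<in>{1..<n}. p (x i) / h (x i) - h (x i) / h (x i))"
      by (rule sum_mono)
    then have "1 / real n * ((\<Sum>i\<in>{1..<n}. ln (p (x i))) - (\<Sum>i\<in>{1..<n}. ln (h (x i)))) \<le>
        1 / real n * ((\<Sum>i\<in>{1..<n}. p (x i) / h (x i)) - (\<Sum>i\<in>{1..<n}. h (x i) / h (x i)))"
      by (intro mult_left_mono) (auto simp: sum_subtractf)
    then have "expected_cum h - 1 / real n * (\<Sum>i\<in>{1..<n}. ln (h (x i))) \<le>
        expected_cum p - 1 / real n * (\<Sum>i\<in>{1..<n}. ln (p (x i)))"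
      using p(2) self by (simp add: dir_deriv_def right_diff_distrib)
    then have "phi n X h \<le> phi n X p"
      using phi_continuous[OF h _ pos] phi_continuous[OF p(1) p_le(1) p_pos] hK by (simp add: K_plus_def)
    also have "phi n X p \<le> phi n X g"
      using p_le(2) p_eq by (rule phi_mono)
    finally show ?thesis .
  qed
  then show ?thesis
    using hK by (auto simp: minimizes_phi_def is_arg_min_def not_less)
qed

end

context ordered_sample
begin

section \<open>The optimality conditions as directional derivatives\<close>

text \<open>
  Exchanging the integrals, the inner one becomes the length of \<open>[s, c]\<close>.
\<close>

lemma double_surv_integral_left:
  assumes "0 \<le> c"
  shows "(\<integral>\<^sup>+ t\<in>{0..c}. (\<integral>\<^sup>+ s\<in>{0..t}. ennreal (emp_surv n X s) \<partial>lborel) \<partial>lborel)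
    = (\<integral>\<^sup>+ s. ennreal (max (c - s) 0) \<partial>surv_measure)"
proof -
  have "(\<integral>\<^sup>+ t\<in>{0..c}. (\<integral>\<^sup>+ s\<in>{0..t}. ennreal (emp_surv n X s) \<partial>lborel) \<partial>lborel)
      = (\<integral>\<^sup>+ t. \<integral>\<^sup>+ s. (if 0 \<le> s \<and> s \<le> t \<and> t \<le> c then ennreal (emp_surv n X s) else 0) \<partial>lborel \<partial>lborel)"
    by (subst nn_integral_multc[symmetric], measurable)
      (auto intro!: nn_integral_cong split: split_indicator)
  also have "\<dots> = (\<integral>\<^sup>+ s. \<integral>\<^sup>+ t. (if 0 \<le> s \<and> s \<le> t \<and> t \<le> c then ennreal (emp_surv n X s) else 0) \<partial>lborel \<partial>lborel)"
    by (rule lborel_pair.Fubini') measurable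
  also have "\<dots> = (\<integral>\<^sup>+ s\<in>{0..}. ennreal (emp_surv n X s) * ennreal (max (c - s) 0) \<partial>lborel)"
  proof (rule nn_integral_cong)
    fix s
    have "(\<integral>\<^sup>+ t. (if 0 \<le> s \<and> s \<le> t \<and> t \<le> c then ennreal (emp_surv n X s) else 0) \<partial>lborel)
        = (\<integral>\<^sup>+ t. ennreal (emp_surv n X s) * indicator {0..} s * indicator {s..c} t \<partial>lborel)"
      by (intro nn_integral_cong) (auto split: split_indicator)
    also have "\<dots> = ennreal (emp_surv n X s) * indicator {0..} s * emeasure lborel {s..c}"
      by (rule nn_integral_cmult_indicator) simp
    also have "emeasure lborel {s..c} = ennreal (max (c - s) 0)"
      by (cases "s \<le> c") auto
    finally show "(\<integral>\<^sup>+ t. (if 0 \<le> s \<and> s \<le> t \<and> t \<le> c then ennreal (emp_surv n X s) else 0) \<partial>lborel)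
        = ennreal (emp_surv n X s) * ennreal (max (c - s) 0) * indicator {0..} s"
      by (simp add: mult_ac)
  qed
  also have "\<dots> = (\<integral>\<^sup>+ s. ennreal (max (c - s) 0) \<partial>surv_measure)"
    by (subst nn_integral_surv_measure) auto
  finally show ?thesis .
qed

lemma double_surv_integral_right:
  assumes "0 \<le> c"
  shows "(\<integral>\<^sup>+ t\<in>{c..}. (\<integral>\<^sup>+ s\<in>{t..}. ennreal (emp_surv n X s) \<partial>lborel) \<partial>lborel)
    = (\<integral>\<^sup>+ s. ennreal (max (s - c) 0) \<partial>surv_measure)"
proof -
  have "(\<integral>\<^sup>+ t\<in>{c..}. (\<integral>\<^sup>+ s\<in>{t..}. ennreal (emp_surv n X s) \<partial>lborel) \<partial>lborel)
      = (\<integral>\<^sup>+ t. \<integral>\<^sup>+ s. (if c \<le> t \<and> t \<le> s then ennreal (emp_surv n X s) else 0) \<partial>lborel \<partial>lborel)"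
    by (subst nn_integral_multc[symmetric], measurable)
      (auto intro!: nn_integral_cong split: split_indicator)
  also have "\<dots> = (\<integral>\<^sup>+ s. \<integral>\<^sup>+ t. (if c \<le> t \<and> t \<le> s then ennreal (emp_surv n X s) else 0) \<partial>lborel \<partial>lborel)"
    by (rule lborel_pair.Fubini') measurable
  also have "\<dots> = (\<integral>\<^sup>+ s\<in>{0..}. ennreal (emp_surv n X s) * ennreal (max (s - c) 0) \<partial>lborel)"
  proof (rule nn_integral_cong)
    fix s
    have "(\<integral>\<^sup>+ t. (if c \<le> t \<and> t \<le> s then ennreal (emp_surv n X s) else 0) \<partial>lborel)
        = (\<integral>\<^sup>+ t. ennreal (emp_surv n X s) * indicator {c..s} t \<partial>lborel)"
      by (intro nn_integral_cong) (auto split: split_indicator)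
    also have "\<dots> = ennreal (emp_surv n X s) * emeasure lborel {c..s}"
      by (rule nn_integral_cmult_indicator) simp
    also have "emeasure lborel {c..s} = ennreal (max (s - c) 0) * indicator {0..} s"
      using assms by (cases "c \<le> s") (auto split: split_indicator)
    finally show "(\<integral>\<^sup>+ t. (if c \<le> t \<and> t \<le> s then ennreal (emp_surv n X s) else 0) \<partial>lborel)
        = ennreal (emp_surv n X s) * ennreal (max (s - c) 0) * indicator {0..} s"
      by (simp add: mult_ac)
  qed
  also have "\<dots> = (\<integral>\<^sup>+ s. ennreal (max (s - c) 0) \<partial>surv_measure)"
    by (subst nn_integral_surv_measure) auto
  finally show ?thesis .
qed

text \<open>
  Both sides are finite, the left one because \<open>h\<close> is positive at the sample points. Comparing them
  is therefore the same as comparing the two real terms of \<open>dir_deriv h p\<close>.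
\<close>

lemma emp_tilde_integral_vs_surv_integral:
  assumes pos: "\<And>i. i \<in> {1..<n} \<Longrightarrow> 0 < h (x i)"
    and p: "continuous_on UNIV p" "\<And>t. 0 \<le> p t"
    and F: "\<And>i. i \<in> {1..<n} \<Longrightarrow> F (x i) = ennreal (p (x i)) / ennreal (h (x i))"
  shows "(\<integral>\<^sup>+ t. F t \<partial>emp_measure_tilde n X) \<le> (\<integral>\<^sup>+ s. ennreal (p s) \<partial>surv_measure) \<longleftrightarrow> 0 \<le> dir_deriv h p"
    and "(\<integral>\<^sup>+ t. F t \<partial>emp_measure_tilde n X) = (\<integral>\<^sup>+ s. ennreal (p s) \<partial>surv_measure) \<longleftrightarrow> dir_deriv h p = 0"
proof -
  let ?D = "1 / real n * (\<Sum>i\<in>{1..<n}. p (x i) / h (x i))"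
  have "(\<Sum>i\<in>{1..<n}. F (x i)) = (\<Sum>i\<in>{1..<n}. ennreal (p (x i) / h (x i)))"
    using pos p by (intro sum.cong) (auto simp: F divide_ennreal)
  also have "\<dots> = ennreal (\<Sum>i\<in>{1..<n}. p (x i) / h (x i))"
    using pos p by (intro sum_ennreal) (auto intro!: divide_nonneg_pos)
  finally have L: "(\<integral>\<^sup>+ t. F t \<partial>emp_measure_tilde n X) = ennreal ?D"
    unfolding nn_integral_emp_measure_tilde using pos p n_pos
    by (subst ennreal_mult) (auto intro!: sum_nonneg divide_nonneg_pos)
  have "0 \<le> ?D"
    using pos p n_pos by (intro mult_nonneg_nonneg sum_nonneg divide_nonneg_pos) auto
  moreover have "(\<integral>\<^sup>+ s. ennreal (p s) \<partial>surv_measure) = ennreal (expected_cum p)" "0 \<le> expected_cum p"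
    using nn_integral_surv_measure_real[OF integrable_surv_measure_continuous[OF p(1)] p(2)] by auto
  ultimately show "(\<integral>\<^sup>+ t. F t \<partial>emp_measure_tilde n X) \<le> (\<integral>\<^sup>+ s. ennreal (p s) \<partial>surv_measure) \<longleftrightarrow> 0 \<le> dir_deriv h p"
    "(\<integral>\<^sup>+ t. F t \<partial>emp_measure_tilde n X) = (\<integral>\<^sup>+ s. ennreal (p s) \<partial>surv_measure) \<longleftrightarrow> dir_deriv h p = 0"
    unfolding L by (auto simp: dir_deriv_def)
qed

lemma left_condition_iff:
  assumes pos: "\<And>i. i \<in> {1..<n} \<Longrightarrow> 0 < h (x i)" and "0 \<le> c"
  shows "(\<integral>\<^sup>+ t\<in>{0..c}. ennreal (c - t) / ennreal (h t) \<partial>emp_measure_tilde n X)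
      \<le> (\<integral>\<^sup>+ t\<in>{0..c}. (\<integral>\<^sup>+ s\<in>{0..t}. ennreal (emp_surv n X s) \<partial>lborel) \<partial>lborel)
      \<longleftrightarrow> 0 \<le> dir_deriv h (\<lambda>t. max (c - t) 0)" (is ?le)
    and "(\<integral>\<^sup>+ t\<in>{0..c}. ennreal (c - t) / ennreal (h t) \<partial>emp_measure_tilde n X)
      = (\<integral>\<^sup>+ t\<in>{0..c}. (\<integral>\<^sup>+ s\<in>{0..t}. ennreal (emp_surv n X s) \<partial>lborel) \<partial>lborel)
      \<longleftrightarrow> dir_deriv h (\<lambda>t. max (c - t) 0) = 0" (is ?eq)
proof -
  have "continuous_on UNIV (\<lambda>t. max (c - t) 0)" by (intro continuous_intros)
  note * = emp_tilde_integral_vs_surv_integral[of h "\<lambda>t. max (c - t) 0", OF pos this]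
  show ?le ?eq
    unfolding double_surv_integral_left[OF \<open>0 \<le> c\<close>] using x_pos
    by (intro *; auto simp: max_def less_imp_le split: split_indicator)+
qed

lemma right_condition_iff:
  assumes pos: "\<And>i. i \<in> {1..<n} \<Longrightarrow> 0 < h (x i)" and "0 \<le> c"
  shows "(\<integral>\<^sup>+ t\<in>{c..}. ennreal (t - c) / ennreal (h t) \<partial>emp_measure_tilde n X)
      \<le> (\<integral>\<^sup>+ t\<in>{c..}. (\<integral>\<^sup>+ s\<in>{t..}. ennreal (emp_surv n X s) \<partial>lborel) \<partial>lborel)
      \<longleftrightarrow> 0 \<le> dir_deriv h (\<lambda>t. max (t - c) 0)" (is ?le)
    and "(\<integral>\<^sup>+ t\<in>{c..}. ennreal (t - c) / ennreal (h t) \<partial>emp_measure_tilde n X)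
      = (\<integral>\<^sup>+ t\<in>{c..}. (\<integral>\<^sup>+ s\<in>{t..}. ennreal (emp_surv n X s) \<partial>lborel) \<partial>lborel)
      \<longleftrightarrow> dir_deriv h (\<lambda>t. max (t - c) 0) = 0" (is ?eq)
proof -
  have "continuous_on UNIV (\<lambda>t. max (t - c) 0)" by (intro continuous_intros)
  note * = emp_tilde_integral_vs_surv_integral[of h "\<lambda>t. max (t - c) 0", OF pos this]
  show ?le ?eq
    unfolding double_surv_integral_right[OF \<open>0 \<le> c\<close>] using x_pos
    by (intro *; auto simp: max_def less_imp_le split: split_indicator)+
qed

lemma surv_measure_1:
  "(\<integral>\<^sup>+ t\<in>{0..}. ennreal (emp_surv n X t) \<partial>lborel) = (\<integral>\<^sup>+ s. ennreal 1 \<partial>surv_measure)"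
  using nn_integral_surv_measure[of "\<lambda>_. 1"] by simp

lemma constant_condition_iff:
  assumes pos: "\<And>i. i \<in> {1..<n} \<Longrightarrow> 0 < h (x i)"
  shows "(\<integral>\<^sup>+ t\<in>{0..}. 1 / ennreal (h t) \<partial>emp_measure_tilde n X)
      \<le> (\<integral>\<^sup>+ t\<in>{0..}. ennreal (emp_surv n X t) \<partial>lborel) \<longleftrightarrow> 0 \<le> dir_deriv h (\<lambda>_. 1)"
  unfolding surv_measure_1 using pos x_pos
  by (intro emp_tilde_integral_vs_surv_integral) (auto simp: less_imp_le split: split_indicator)

text \<open>
  The right-hand side is the sample mean, hence finite, while a zero of \<open>h\<close> at a sample point would
  contribute \<open>1 / 0 = \<infinity>\<close> on the left.
\<close>

lemma positive_of_constant_condition: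
  assumes le: "(\<integral>\<^sup>+ t\<in>{0..}. 1 / ennreal (h t) \<partial>emp_measure_tilde n X)
      \<le> (\<integral>\<^sup>+ t\<in>{0..}. ennreal (emp_surv n X t) \<partial>lborel)"
    and i: "i \<in> {1..<n}"
  shows "0 < h (x i)"
proof (rule ccontr)
  assume "\<not> 0 < h (x i)"
  then have "1 / ennreal (h (x i)) = top" "0 \<le> x i"
    using x_pos[of i] i by (simp_all add: ennreal_neg not_less less_imp_le)
  then have "(\<Sum>i\<in>{1..<n}. 1 / ennreal (h (x i)) * indicator {0..} (x i)) = top"
    using i by (auto intro!: exI[of _ i])
  then have "(\<integral>\<^sup>+ t\<in>{0..}. 1 / ennreal (h t) \<partial>emp_measure_tilde n X) = top"
    using n_pos by (simp only: nn_integral_emp_measure_tilde) (simp add: ennreal_mult_top)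
  moreover have "(\<integral>\<^sup>+ s. ennreal 1 \<partial>surv_measure) \<le> ennreal (1 * b)"
    by (rule nn_integral_surv_measure_bounded_finite) auto
  ultimately show False
    using le by (auto simp: surv_measure_1 top_unique)
qed

lemma cum_hazard_condition_iff:
  assumes h: "continuous_on UNIV h" and nonneg: "\<And>t. 0 \<le> t \<Longrightarrow> t < b \<Longrightarrow> 0 \<le> h t"
    and pos: "\<And>i. i \<in> {1..<n} \<Longrightarrow> 0 < h (x i)"
  shows "(\<integral>\<^sup>+ t\<in>{0..}. cum_hazard h t \<partial>emp_measure n X) = ennreal (1 - 1 / real n) \<longleftrightarrow> dir_deriv h h = 0"
proof -
  have "(\<Sum>i\<in>{1..n}. cum_hazard h (x i) * indicator {0..} (x i)) = (\<Sum>i\<in>{1..n}. cum_hazard h (x i))"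
    using x_pos by (intro sum.cong) (auto simp: less_imp_le)
  then have "(\<integral>\<^sup>+ t\<in>{0..}. cum_hazard h t \<partial>emp_measure n X) = ennreal (expected_cum h)"
    unfolding nn_integral_emp_measure by (simp only: sum_cum_hazard[OF h nonneg])
  moreover have "0 \<le> expected_cum h"
    by (rule nn_integral_surv_measure_real(2)[OF integrable_surv_measure_continuous[OF h] nonneg])
  moreover have "0 \<le> 1 - 1 / real n"
    using n_pos by simp
  ultimately show ?thesis
    using dir_deriv_self[of h] pos by simp
qed

section \<open>First-order condition at a point of change of slope\<close>

lemma dir_deriv_le_of_small_support:
  assumes [measurable]: "q \<in> borel_measurable borel"
    and q: "\<And>t. 0 \<le> q t" "\<And>t. q t \<le> d * indicator {l<..<l + d} t" and "0 < d"
    and "\<And>i. i \<in> {1..<n} \<Longrightarrow> q (x i) = 0"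
  shows "dir_deriv h q \<le> d * d"
proof -
  have int: "integrable surv_measure q"
    using q \<open>0 < d\<close> by (intro integrable_surv_measure[of _ d])
      (auto intro: order_trans[OF q(2)] split: split_indicator)
  have "ennreal (expected_cum q) = (\<integral>\<^sup>+ s. ennreal (q s) \<partial>surv_measure)"
    using nn_integral_surv_measure_real(1)[OF int q(1)] by simp
  also have "\<dots> = (\<integral>\<^sup>+ s\<in>{0..}. ennreal (emp_surv n X s) * ennreal (q s) \<partial>lborel)"
    by (rule nn_integral_surv_measure) simp
  also have "\<dots> \<le> (\<integral>\<^sup>+ s. ennreal d * indicator {l<..<l + d} s \<partial>lborel)"
  proof (rule nn_integral_mono)
    fix s
    have "ennreal (emp_surv n X s) * ennreal (q s) * indicator {0..} s \<le> 1 * ennreal (q s) * 1"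
      using emp_surv_le_1[of s] by (intro mult_mono) (auto split: split_indicator)
    also have "\<dots> \<le> ennreal d * indicator {l<..<l + d} s"
      using q(2)[of s] q(1)[of s] by (auto split: split_indicator_asm split_indicator simp: ennreal_leI)
    finally show "ennreal (emp_surv n X s) * ennreal (q s) * indicator {0..} s \<le> ennreal d * indicator {l<..<l + d} s" .
  qed
  also have "\<dots> = ennreal (d * d)"
    using \<open>0 < d\<close> by (simp add: nn_integral_cmult_indicator ennreal_mult)
  finally have "expected_cum q \<le> d * d"
    using \<open>0 < d\<close> by simp
  then show ?thesis
    using assms(5) by (simp add: dir_deriv_def)
qed

text \<open>
  The sign \<open>\<sigma>\<close> selects the hinges \<open>(c - t)\<^sub>+\<close> or \<open>(t - c)\<^sub>+\<close>. With \<open>u = \<sigma> (z - t)\<close>, moving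
  \<open>z\<close> by \<open>\<plusminus>d\<close> turns \<open>u\<^sub>+\<close> into \<open>(u \<plusminus> d)\<^sub>+\<close>, which differs from \<open>u\<^sub>+ + d 1\<^bsub>{u \<ge> 0}\<^esub>\<close>, respectively
  \<open>u\<^sub>+ - d 1\<^bsub>{u > 0}\<^esub>\<close>, by at most \<open>d\<close> on an interval of length \<open>d\<close>. For small \<open>d\<close> this interval
  contains no sample point, so the error is \<open>O(d\<^sup>2)\<close>. The minimum at \<open>z\<close> then makes the derivative nonnegative for
  \<open>{u \<ge> 0}\<close> and nonpositive for \<open>{u > 0}\<close>. The first value is at most the second, since they differ
  by the nonnegative term of a possible sample point at \<open>z\<close>; so both are zero.
\<close>

lemma dir_deriv_half_line_eq_0:
  assumes pos: "\<And>i. i \<in> {1..<n} \<Longrightarrow> 0 < h (x i)"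
    and \<sigma>: "\<sigma> = 1 \<or> \<sigma> = - 1" and "0 < z"
    and nonneg: "\<And>c. 0 \<le> c \<Longrightarrow> 0 \<le> dir_deriv h (\<lambda>t. max (\<sigma> * (c - t)) 0)"
    and zero: "dir_deriv h (\<lambda>t. max (\<sigma> * (z - t)) 0) = 0"
  shows "dir_deriv h (\<lambda>t. if 0 \<le> \<sigma> * (z - t) then 1 else 0) = 0"
    and "dir_deriv h (\<lambda>t. if 0 < \<sigma> * (z - t) then 1 else 0) = 0"
proof -
  let ?H = "\<lambda>c t. max (\<sigma> * (c - t)) 0"
  let ?A = "\<lambda>t. if 0 \<le> \<sigma> * (z - t) then 1 else 0 :: real"
  let ?B = "\<lambda>t. if 0 < \<sigma> * (z - t) then 1 else 0 :: real"
  have intH: "integrable surv_measure (?H c)" for c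
    by (intro integrable_surv_measure_continuous continuous_intros)
  have "?A = indicator {t. 0 \<le> \<sigma> * (z - t)}" "?B = indicator {t. 0 < \<sigma> * (z - t)}"
    by (auto simp: fun_eq_iff)
  moreover have "{t. 0 \<le> \<sigma> * (z - t)} \<in> sets borel" "{t. 0 < \<sigma> * (z - t)} \<in> sets borel"
    by (intro borel_closed closed_Collect_le borel_open open_Collect_less continuous_intros)+
  ultimately have A[measurable]: "?A \<in> borel_measurable borel" and B[measurable]: "?B \<in> borel_measurable borel"
    by (simp_all only: borel_measurable_indicator)
  have intA: "integrable surv_measure ?A" and intB: "integrable surv_measure ?B"
    using A B by (auto intro!: integrable_surv_measure[of _ 1])
  have "dir_deriv h (\<lambda>t. ?A t + (- 1) * ?B t) \<le> 0"
  proof -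
    have "AE t in surv_measure. t \<noteq> z"
      unfolding surv_measure_def using AE_lborel_singleton[of z] by (subst AE_density) auto
    then have "AE t in surv_measure. ?A t + (- 1) * ?B t = 0"
      by eventually_elim (use \<sigma> in auto)
    then have "expected_cum (\<lambda>t. ?A t + (- 1) * ?B t) = expected_cum (\<lambda>t. 0)"
      unfolding expected_cum_def by (intro integral_cong_AE) (auto simp: measurable_cong_sets[OF sets_surv_measure refl])
    moreover have "0 \<le> (\<Sum>i\<in>{1..<n}. (?A (x i) + (- 1) * ?B (x i)) / h (x i))"
      using pos by (intro sum_nonneg divide_nonneg_pos) auto
    ultimately show ?thesis
      using n_pos by (simp add: dir_deriv_def expected_cum_def del: mult_minus1)
  qed
  moreover have "dir_deriv h (\<lambda>t. ?A t + (- 1) * ?B t) = dir_deriv h ?A + (- 1) * dir_deriv h ?B"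
    by (subst dir_deriv_add) (intro intA integrable_mult_right intB, intro integrable_mult_right intB, simp only: dir_deriv_cmult)
  ultimately have AB: "dir_deriv h ?A \<le> dir_deriv h ?B"
    by linarith
  obtain d0 where "0 < d0" and d0: "\<And>i. i \<in> {1..<n} \<Longrightarrow> x i \<noteq> z \<Longrightarrow> d0 \<le> \<bar>z - x i\<bar>"
    using finite_set_avoid[of "x ` {1..<n}" z] by (auto simp: dist_real_def)
  have bounds: "- d \<le> dir_deriv h ?A" "dir_deriv h ?B \<le> d" if d: "0 < d" "d \<le> d0" "d \<le> z" for d
  proof -
    have far: "\<bar>\<sigma> * (z - x i)\<bar> \<ge> d \<or> x i = z" if "i \<in> {1..<n}" for i
      using d0[OF that] d \<sigma> by (auto simp: abs_mult)
    let ?q = "\<lambda>t. ?H (z + \<sigma> * d) t + ((- 1) * ?H z t + (- d) * ?A t)"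
    have u: "\<sigma> * (z + \<sigma> * d - t) = \<sigma> * (z - t) + d" "\<sigma> * (z - \<sigma> * d - t) = \<sigma> * (z - t) - d" for t
      using \<sigma> by (auto simp: algebra_simps)
    have "dir_deriv h ?q \<le> d * d"
    proof (rule dir_deriv_le_of_small_support[where l = "if \<sigma> = 1 then z else z - d"])
      show "0 \<le> ?q t" for t
        unfolding u using d by auto
      show "?q t \<le> d * indicator {(if \<sigma> = 1 then z else z - d)<..<(if \<sigma> = 1 then z else z - d) + d} t" for t
        unfolding u using \<sigma> d by (auto split: split_indicator)
      show "?q (x i) = 0" if "i \<in> {1..<n}" for i
        unfolding u using far[OF that] d by auto
    qed (use d in auto)
    moreover have "dir_deriv h ?q = dir_deriv h (?H (z + \<sigma> * d)) + ((- 1) * dir_deriv h (?H z) + (- d) * dir_deriv h ?A)"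
      by (subst dir_deriv_add dir_deriv_cmult; (intro integrable_mult_right intH intA Bochner_Integration.integrable_add)?)+ (rule refl)
    moreover have "0 \<le> dir_deriv h (?H (z + \<sigma> * d))"
      using d \<sigma> by (intro nonneg) auto
    ultimately have "d * (- dir_deriv h ?A) \<le> d * d"
      using zero by simp
    then show "- d \<le> dir_deriv h ?A"
      using d by (subst (asm) mult_le_cancel_left_pos) auto
    let ?r = "\<lambda>t. ?H (z - \<sigma> * d) t + ((- 1) * ?H z t + d * ?B t)"
    have "dir_deriv h ?r \<le> d * d"
    proof (rule dir_deriv_le_of_small_support[where l = "if \<sigma> = 1 then z - d else z"])
      show "0 \<le> ?r t" for t
        unfolding u using d by auto
      show "?r t \<le> d * indicator {(if \<sigma> = 1 then z - d else z)<..<(if \<sigma> = 1 then z - d else z) + d} t" for t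
        unfolding u using \<sigma> d by (auto split: split_indicator)
      show "?r (x i) = 0" if "i \<in> {1..<n}" for i
        unfolding u using far[OF that] d by auto
    qed (use d in auto)
    moreover have "dir_deriv h ?r = dir_deriv h (?H (z - \<sigma> * d)) + ((- 1) * dir_deriv h (?H z) + d * dir_deriv h ?B)"
      by (subst dir_deriv_add dir_deriv_cmult; (intro integrable_mult_right intH intB Bochner_Integration.integrable_add)?)+ (rule refl)
    moreover have "0 \<le> dir_deriv h (?H (z - \<sigma> * d))"
      using d \<sigma> by (intro nonneg) auto
    ultimately have "d * dir_deriv h ?B \<le> d * d"
      using zero by simp
    then show "dir_deriv h ?B \<le> d"
      using d by (subst (asm) mult_le_cancel_left_pos) auto
  qed
  have "0 \<le> dir_deriv h ?A"
  proof (rule ccontr)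
    assume neg: "\<not> ?thesis"
    define d where "d = min (min d0 z) (- dir_deriv h ?A / 2)"
    have "0 < d" "d \<le> d0" "d \<le> z" "d \<le> - dir_deriv h ?A / 2"
      using neg \<open>0 < d0\<close> \<open>0 < z\<close> unfolding d_def by linarith+
    with bounds(1)[of d] neg show False by linarith
  qed
  moreover have "dir_deriv h ?B \<le> 0"
  proof (rule ccontr)
    assume neg: "\<not> ?thesis"
    define d where "d = min (min d0 z) (dir_deriv h ?B / 2)"
    have "0 < d" "d \<le> d0" "d \<le> z" "d \<le> dir_deriv h ?B / 2"
      using neg \<open>0 < d0\<close> \<open>0 < z\<close> unfolding d_def by linarith+
    with bounds(2)[of d] neg show False by linarith
  qed
  ultimately show "dir_deriv h ?A = 0" "dir_deriv h ?B = 0"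
    using AB by auto
qed

end

section \<open>One-sided slopes and convexity of hinges\<close>

lemma hinge_one_sided_derivatives:
  fixes c p :: real
  shows "((\<lambda>t. max (c - t) 0) has_real_derivative (if p \<le> c then - 1 else 0)) (at_left p)"
    and "((\<lambda>t. max (c - t) 0) has_real_derivative (if p < c then - 1 else 0)) (at_right p)"
    and "((\<lambda>t. max (t - c) 0) has_real_derivative (if c < p then 1 else 0)) (at_left p)"
    and "((\<lambda>t. max (t - c) 0) has_real_derivative (if c \<le> p then 1 else 0)) (at_right p)"
proof -
  have cong: "(f has_real_derivative D) (at p within S)"
    if "(g has_real_derivative D) (at p within S)" "\<forall>\<^sub>F t in at p within S. f t = g t" "f p = g p"
    for f g :: "real \<Rightarrow> real" and D S
    using that has_field_derivative_cong_eventually[of f g p S] by blast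
  have left: "\<forall>\<^sub>F t in at_left p. l < t \<and> t < p" if "l < p" for l :: real
    using eventually_at_left_real[OF that] by (auto elim: eventually_mono)
  have right: "\<forall>\<^sub>F t in at_right p. p < t \<and> t < r" if "p < r" for r :: real
    using eventually_at_right_real[OF that] by (auto elim: eventually_mono)
  have lt: "\<forall>\<^sub>F t in at_left p. t < p" and gt: "\<forall>\<^sub>F t in at_right p. p < t"
    by (auto simp: eventually_at_filter)
  show "((\<lambda>t. max (c - t) 0) has_real_derivative (if p \<le> c then - 1 else 0)) (at_left p)"
  proof (cases "p \<le> c")
    case True
    have "((\<lambda>t. c - t) has_real_derivative - 1) (at_left p)"
      by (auto intro!: derivative_eq_intros)
    then have "((\<lambda>t. max (c - t) 0) has_real_derivative - 1) (at_left p)"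
      by (rule cong) (use True in \<open>auto intro: eventually_mono[OF lt]\<close>)
    then show ?thesis using True by simp
  next
    case False
    have "((\<lambda>t. 0) has_real_derivative 0) (at_left p)" by simp
    then have "((\<lambda>t. max (c - t) 0) has_real_derivative 0) (at_left p)"
      by (rule cong) (use False in \<open>auto intro: eventually_mono[OF left[of c]]\<close>)
    then show ?thesis using False by simp
  qed
  show "((\<lambda>t. max (c - t) 0) has_real_derivative (if p < c then - 1 else 0)) (at_right p)"
  proof (cases "p < c")
    case True
    have "((\<lambda>t. c - t) has_real_derivative - 1) (at_right p)"
      by (auto intro!: derivative_eq_intros)
    then have "((\<lambda>t. max (c - t) 0) has_real_derivative - 1) (at_right p)"
      by (rule cong) (use True in \<open>auto intro: eventually_mono[OF right[of c]]\<close>)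
    then show ?thesis using True by simp
  next
    case False
    have "((\<lambda>t. 0) has_real_derivative 0) (at_right p)" by simp
    then have "((\<lambda>t. max (c - t) 0) has_real_derivative 0) (at_right p)"
      by (rule cong) (use False in \<open>auto intro: eventually_mono[OF gt]\<close>)
    then show ?thesis using False by simp
  qed
  show "((\<lambda>t. max (t - c) 0) has_real_derivative (if c < p then 1 else 0)) (at_left p)"
  proof (cases "c < p")
    case True
    have "((\<lambda>t. t - c) has_real_derivative 1) (at_left p)"
      by (auto intro!: derivative_eq_intros)
    then have "((\<lambda>t. max (t - c) 0) has_real_derivative 1) (at_left p)"
      by (rule cong) (use True in \<open>auto intro: eventually_mono[OF left[of c]]\<close>)
    then show ?thesis using True by simp
  next
    case False
    have "((\<lambda>t. 0) has_real_derivative 0) (at_left p)" by simp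
    then have "((\<lambda>t. max (t - c) 0) has_real_derivative 0) (at_left p)"
      by (rule cong) (use False in \<open>auto intro: eventually_mono[OF lt]\<close>)
    then show ?thesis using False by simp
  qed
  show "((\<lambda>t. max (t - c) 0) has_real_derivative (if c \<le> p then 1 else 0)) (at_right p)"
  proof (cases "c \<le> p")
    case True
    have "((\<lambda>t. t - c) has_real_derivative 1) (at_right p)"
      by (auto intro!: derivative_eq_intros)
    then have "((\<lambda>t. max (t - c) 0) has_real_derivative 1) (at_right p)"
      by (rule cong) (use True in \<open>auto intro: eventually_mono[OF gt]\<close>)
    then show ?thesis using True by simp
  next
    case False
    have "((\<lambda>t. 0) has_real_derivative 0) (at_right p)" by simp
    then have "((\<lambda>t. max (t - c) 0) has_real_derivative 0) (at_right p)"
      by (rule cong) (use False in \<open>auto intro: eventually_mono[OF right[of c]]\<close>)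
    then show ?thesis using False by simp
  qed
qed

lemma convex_on_hinge:
  fixes c :: real
  assumes "convex S"
  shows "convex_on S (\<lambda>t. max (c - t) 0)" "convex_on S (\<lambda>t. max (t - c) 0)"
proof -
  have "max (c - (u * s + v * t)) 0 \<le> u * max (c - s) 0 + v * max (c - t) 0"
    "max (u * s + v * t - c) 0 \<le> u * max (s - c) 0 + v * max (t - c) 0"
    if "0 \<le> u" "0 \<le> v" "u + v = 1" for u v s t
  proof -
    have "u * (c - s) \<le> u * max (c - s) 0" "v * (c - t) \<le> v * max (c - t) 0"
      "u * (s - c) \<le> u * max (s - c) 0" "v * (t - c) \<le> v * max (t - c) 0"
      using that by (auto intro!: mult_left_mono)
    moreover have "c = u * c + v * c"
      using that by (simp flip: distrib_right)
    moreover have "0 \<le> u * max (c - s) 0 + v * max (c - t) 0" "0 \<le> u * max (s - c) 0 + v * max (t - c) 0"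
      using that by auto
    ultimately show "max (c - (u * s + v * t)) 0 \<le> u * max (c - s) 0 + v * max (c - t) 0"
      "max (u * s + v * t - c) 0 \<le> u * max (s - c) 0 + v * max (t - c) 0"
      by (auto simp: right_diff_distrib)
  qed
  then show "convex_on S (\<lambda>t. max (c - t) 0)" "convex_on S (\<lambda>t. max (t - c) 0)"
    using assms by (auto simp: convex_on_def)
qed

context ordered_sample
begin

lemma K_plus_const: "0 \<le> c \<Longrightarrow> (\<lambda>_. c) \<in> K_plus n X"
  by (simp add: K_plus_def convex_on_const)

lemma K_plus_hinge: "(\<lambda>t. max (c - t) 0) \<in> K_plus n X" "(\<lambda>t. max (t - c) 0) \<in> K_plus n X"
  by (auto simp: K_plus_def intro!: convex_on_hinge)

lemma K_plus_add: "f \<in> K_plus n X \<Longrightarrow> g \<in> K_plus n X \<Longrightarrow> (\<lambda>t. f t + g t) \<in> K_plus n X"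
  by (auto simp: K_plus_def)

lemma K_plus_cmult: "0 \<le> c \<Longrightarrow> f \<in> K_plus n X \<Longrightarrow> (\<lambda>t. c * f t) \<in> K_plus n X"
  by (auto simp: K_plus_def)

lemma K_plus_sum:
  "(\<And>j. j \<in> J \<Longrightarrow> f j \<in> K_plus n X) \<Longrightarrow> (\<lambda>t. \<Sum>j\<in>J. f j t) \<in> K_plus n X"
  by (induction J rule: infinite_finite_induct) (auto intro: K_plus_const K_plus_add)

end

section \<open>Hazards that are combinations of hinges\<close>

locale hinge_hazard = ordered_sample n X for n :: nat and X :: "nat \<Rightarrow> real" +
  fixes k m :: nat and h :: "real \<Rightarrow> real" and a :: real and \<nu> \<tau> \<mu> \<eta> :: "nat \<Rightarrow> real"
  assumes h_repr: "\<And>t. 0 \<le> t \<Longrightarrow> t < b \<Longrightarrow>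
        h t = a + (\<Sum>j\<in>{1..k}. \<nu> j * max (\<tau> j - t) 0) + (\<Sum>j\<in>{1..m}. \<mu> j * max (t - \<eta> j) 0)"
    and a_nonneg: "0 \<le> a"
    and \<nu>_nonneg: "\<And>j. j \<in> {1..k} \<Longrightarrow> 0 \<le> \<nu> j"
    and \<mu>_nonneg: "\<And>j. j \<in> {1..m} \<Longrightarrow> 0 \<le> \<mu> j"
    and \<tau>_strict: "strict_mono_on {1..k} \<tau>"
    and \<eta>_strict: "strict_mono_on {1..m} \<eta>"
    and \<tau>_slope: "\<tau> ` {1..k} = decreasing_slope_changes h b"
    and \<eta>_slope: "\<eta> ` {1..m} = increasing_slope_changes h b"
    and \<tau>_le_\<eta>: "k \<ge> 1 \<Longrightarrow> m \<ge> 1 \<Longrightarrow> \<tau> k \<le> \<eta> 1"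
begin

text \<open>
  The coefficients are parameters because perturbing \<open>h\<close> amounts to changing one of them.
\<close>

definition hinges :: "(nat \<Rightarrow> real) \<Rightarrow> (nat \<Rightarrow> real) \<Rightarrow> real \<Rightarrow> real" where
  "hinges v w t = a + (\<Sum>j\<in>{1..k}. v j * max (\<tau> j - t) 0) + (\<Sum>j\<in>{1..m}. w j * max (t - \<eta> j) 0)"

text \<open>
  The continuous extension of \<open>h\<close> from \<open>[0, b)\<close> to the real line. The values of \<open>h\<close> itself outside
  \<open>[0, b)\<close> are arbitrary.
\<close>

abbreviation h_ext :: "real \<Rightarrow> real" where "h_ext \<equiv> hinges \<nu> \<mu>"

lemma h_eq_h_ext: "0 \<le> t \<Longrightarrow> t < b \<Longrightarrow> h t = h_ext t"
  by (simp add: hinges_def h_repr)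

lemma hinges_in_K_plus:
  assumes "\<And>j. j \<in> {1..k} \<Longrightarrow> 0 \<le> v j" "\<And>j. j \<in> {1..m} \<Longrightarrow> 0 \<le> w j"
  shows "hinges v w \<in> K_plus n X"
  unfolding hinges_def[abs_def] using assms a_nonneg
  by (intro K_plus_add K_plus_sum K_plus_cmult K_plus_hinge K_plus_const) auto

lemma h_ext_in_K_plus: "h_ext \<in> K_plus n X"
  using \<nu>_nonneg \<mu>_nonneg by (rule hinges_in_K_plus)

lemma continuous_h_ext: "continuous_on UNIV h_ext"
  unfolding hinges_def[abs_def] by (intro continuous_intros)

lemma h_ext_nonneg: "0 \<le> t \<Longrightarrow> t < b \<Longrightarrow> 0 \<le> h_ext t"
  using h_ext_in_K_plus by (auto simp: K_plus_def)

lemma \<tau>_in: "0 < \<tau> i" "\<tau> i < b" if "i \<in> {1..k}"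
  using that \<tau>_slope by (auto simp: decreasing_slope_changes_def)

lemma \<eta>_in: "0 < \<eta> j" "\<eta> j < b" if "j \<in> {1..m}"
  using that \<eta>_slope by (auto simp: increasing_slope_changes_def)

lemma \<tau>_le_\<eta>_all: "\<tau> i \<le> \<eta> j" if "i \<in> {1..k}" "j \<in> {1..m}"
proof -
  have "\<tau> i \<le> \<tau> k"
    using strict_mono_onD[OF \<tau>_strict, of i k] that by (cases "i = k") auto
  moreover have "\<eta> 1 \<le> \<eta> j"
    using strict_mono_onD[OF \<eta>_strict, of 1 j] that by (cases "j = 1") auto
  ultimately show ?thesis
    using \<tau>_le_\<eta> that by auto
qed

lemma \<tau>_inj: "\<tau> i = \<tau> j \<Longrightarrow> i \<in> {1..k} \<Longrightarrow> j \<in> {1..k} \<Longrightarrow> i = j"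
  using strict_mono_on_imp_inj_on[OF \<tau>_strict] by (auto dest: inj_onD)

lemma \<eta>_inj: "\<eta> i = \<eta> j \<Longrightarrow> i \<in> {1..m} \<Longrightarrow> j \<in> {1..m} \<Longrightarrow> i = j"
  using strict_mono_on_imp_inj_on[OF \<eta>_strict] by (auto dest: inj_onD)

lemma slope_change_at_h_ext:
  assumes p: "0 < p" "p < b" and change: "slope_change_at h p l r"
  shows "l = (\<Sum>j\<in>{1..k}. \<nu> j * (if p \<le> \<tau> j then - 1 else 0)) + (\<Sum>j\<in>{1..m}. \<mu> j * (if \<eta> j < p then 1 else 0))"
    and "r = (\<Sum>j\<in>{1..k}. \<nu> j * (if p < \<tau> j then - 1 else 0)) + (\<Sum>j\<in>{1..m}. \<mu> j * (if \<eta> j \<le> p then 1 else 0))"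
proof -
  have "\<forall>\<^sub>F t in at p within S. h t = h_ext t" for S
  proof -
    have "\<forall>\<^sub>F t in nhds p. t \<in> {0<..<b}"
      using p by (intro eventually_nhds_in_open) auto
    then show ?thesis
      by (auto simp: eventually_at_filter h_eq_h_ext elim!: eventually_mono)
  qed
  then have eq: "(h has_real_derivative D) (at p within S) \<longleftrightarrow> (h_ext has_real_derivative D) (at p within S)" for D S
    by (intro has_field_derivative_cong_eventually) (use p h_eq_h_ext in auto)
  have "(h_ext has_real_derivative
      (0 + (\<Sum>j\<in>{1..k}. \<nu> j * (if p \<le> \<tau> j then - 1 else 0)) + (\<Sum>j\<in>{1..m}. \<mu> j * (if \<eta> j < p then 1 else 0)))) (at_left p)"
    unfolding hinges_def[abs_def]
    by (intro DERIV_add DERIV_const DERIV_sum DERIV_cmult hinge_one_sided_derivatives)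
  moreover have "(h_ext has_real_derivative l) (at_left p)"
    using change by (simp add: slope_change_at_def eq)
  ultimately show "l = (\<Sum>j\<in>{1..k}. \<nu> j * (if p \<le> \<tau> j then - 1 else 0)) + (\<Sum>j\<in>{1..m}. \<mu> j * (if \<eta> j < p then 1 else 0))"
    using has_field_derivative_unique[of h_ext l p "{..<p}"] by simp
  have "(h_ext has_real_derivative
      (0 + (\<Sum>j\<in>{1..k}. \<nu> j * (if p < \<tau> j then - 1 else 0)) + (\<Sum>j\<in>{1..m}. \<mu> j * (if \<eta> j \<le> p then 1 else 0)))) (at_right p)"
    unfolding hinges_def[abs_def]
    by (intro DERIV_add DERIV_const DERIV_sum DERIV_cmult hinge_one_sided_derivatives)
  moreover have "(h_ext has_real_derivative r) (at_right p)"
    using change by (simp add: slope_change_at_def eq)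
  ultimately show "r = (\<Sum>j\<in>{1..k}. \<nu> j * (if p < \<tau> j then - 1 else 0)) + (\<Sum>j\<in>{1..m}. \<mu> j * (if \<eta> j \<le> p then 1 else 0))"
    using has_field_derivative_unique[of h_ext r p "{p<..}"] by simp
qed

text \<open>
  If the coefficient is zero, a slope change at \<open>\<tau> i\<close> can only come from an increasing hinge at the same
  point. But then no \<open>\<tau> j\<close> lies to the right of \<open>\<tau> i\<close>, so the left slope is zero and not
  negative.
\<close>

lemma \<nu>_pos: "0 < \<nu> i" if i: "i \<in> {1..k}"
proof (rule ccontr)
  assume "\<not> 0 < \<nu> i"
  then have zero: "\<nu> i = 0" using \<nu>_nonneg[OF i] by simp
  obtain l r where change: "slope_change_at h (\<tau> i) l r" and "l < 0"
    using imageI[OF i, of \<tau>] unfolding \<tau>_slope by (auto simp: decreasing_slope_changes_def)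
  have "l \<noteq> r" using change by (simp add: slope_change_at_def)
  note lr = slope_change_at_h_ext[OF \<tau>_in[OF i] change]
  have \<nu>_sums: "(\<Sum>j\<in>{1..k}. \<nu> j * (if \<tau> i \<le> \<tau> j then - 1 else 0)) = (\<Sum>j\<in>{1..k}. \<nu> j * (if \<tau> i < \<tau> j then - 1 else 0))"
    using zero i by (intro sum.cong) (auto dest: \<tau>_inj)
  have \<mu>_left: "(\<Sum>j\<in>{1..m}. \<mu> j * (if \<eta> j < \<tau> i then 1 else 0)) = 0"
    using \<tau>_le_\<eta>_all[OF i] by (intro sum.neutral) force
  have "\<exists>j\<in>{1..m}. \<eta> j \<le> \<tau> i"
  proof (rule ccontr)
    assume "\<not> ?thesis"
    then have "(\<Sum>j\<in>{1..m}. \<mu> j * (if \<eta> j \<le> \<tau> i then 1 else 0)) = 0"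
      by (intro sum.neutral) auto
    with lr \<nu>_sums \<mu>_left \<open>l \<noteq> r\<close> show False by simp
  qed
  then obtain j where j: "j \<in> {1..m}" "\<eta> j \<le> \<tau> i" by auto
  have "(\<Sum>j\<in>{1..k}. \<nu> j * (if \<tau> i < \<tau> j then - 1 else 0)) = 0"
    using \<tau>_le_\<eta>_all[OF _ j(1)] j(2) by (intro sum.neutral) force
  then have "l = 0" using lr \<nu>_sums \<mu>_left by simp
  with \<open>l < 0\<close> show False by simp
qed

lemma \<mu>_pos: "0 < \<mu> i" if i: "i \<in> {1..m}"
proof (rule ccontr)
  assume "\<not> 0 < \<mu> i"
  then have zero: "\<mu> i = 0" using \<mu>_nonneg[OF i] by simp
  obtain l r where change: "slope_change_at h (\<eta> i) l r" and "0 < r"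
    using imageI[OF i, of \<eta>] unfolding \<eta>_slope by (auto simp: increasing_slope_changes_def)
  have "l \<noteq> r" using change by (simp add: slope_change_at_def)
  note lr = slope_change_at_h_ext[OF \<eta>_in[OF i] change]
  have \<mu>_sums: "(\<Sum>j\<in>{1..m}. \<mu> j * (if \<eta> j < \<eta> i then 1 else 0)) = (\<Sum>j\<in>{1..m}. \<mu> j * (if \<eta> j \<le> \<eta> i then 1 else 0))"
    using zero i by (intro sum.cong) (auto dest: \<eta>_inj)
  have \<nu>_right: "(\<Sum>j\<in>{1..k}. \<nu> j * (if \<eta> i < \<tau> j then - 1 else 0)) = 0"
    using \<tau>_le_\<eta>_all[OF _ i] by (intro sum.neutral) force
  have "\<exists>j\<in>{1..k}. \<eta> i \<le> \<tau> j"
  proof (rule ccontr)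
    assume "\<not> ?thesis"
    then have "(\<Sum>j\<in>{1..k}. \<nu> j * (if \<eta> i \<le> \<tau> j then - 1 else 0)) = 0"
      by (intro sum.neutral) auto
    with lr \<mu>_sums \<nu>_right \<open>l \<noteq> r\<close> show False by simp
  qed
  then obtain j where j: "j \<in> {1..k}" "\<eta> i \<le> \<tau> j" by auto
  have "(\<Sum>j\<in>{1..m}. \<mu> j * (if \<eta> j < \<eta> i then 1 else 0)) = 0"
    using \<tau>_le_\<eta>_all[OF j(1)] j(2) by (intro sum.neutral) force
  then have "r = 0" using lr \<mu>_sums \<nu>_right by simp
  with \<open>0 < r\<close> show False by simp
qed

lemma minimizes_phi_h_ext: "minimizes_phi n X h \<longleftrightarrow> minimizes_phi n X h_ext"
  using phi_cong[of h h_ext, OF h_eq_h_ext] K_plus_cong[of h h_ext, OF h_eq_h_ext]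
  by (simp add: minimizes_phi_def is_arg_min_def)

text \<open>
  The equalities hold because \<open>h\<close> can be moved in both directions: along its own ray, and along each of its hinges as
  long as the coefficient stays nonnegative.
\<close>

lemma dir_deriv_minimizer:
  assumes min: "minimizes_phi n X h_ext"
  shows "0 \<le> dir_deriv h_ext (\<lambda>t. max (c - t) 0)" "0 \<le> dir_deriv h_ext (\<lambda>t. max (t - c) 0)"
    "0 \<le> dir_deriv h_ext (\<lambda>_. 1)" "dir_deriv h_ext h_ext = 0"
    "i \<in> {1..k} \<Longrightarrow> dir_deriv h_ext (\<lambda>t. max (\<tau> i - t) 0) = 0"
    "j \<in> {1..m} \<Longrightarrow> dir_deriv h_ext (\<lambda>t. max (t - \<eta> j) 0) = 0"
proof -
  have up: "0 \<le> dir_deriv h_ext p" if "continuous_on UNIV p" "p \<in> K_plus n X" for p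
    using that by (intro dir_deriv_nonneg_of_minimizer[OF min continuous_h_ext, of _ 1] K_plus_add h_ext_in_K_plus K_plus_cmult) auto
  have down: "dir_deriv h_ext p \<le> 0"
    if "continuous_on UNIV p" "0 < r" "\<And>\<epsilon>. 0 < \<epsilon> \<Longrightarrow> \<epsilon> < r \<Longrightarrow> (\<lambda>t. h_ext t - \<epsilon> * p t) \<in> K_plus n X" for p r
  proof -
    have "0 \<le> dir_deriv h_ext (\<lambda>t. (- 1) * p t)"
      using that by (intro dir_deriv_nonneg_of_minimizer[OF min continuous_h_ext, of _ r] continuous_intros) auto
    then show ?thesis by (simp only: dir_deriv_cmult)
  qed
  show left: "0 \<le> dir_deriv h_ext (\<lambda>t. max (c - t) 0)" and right: "0 \<le> dir_deriv h_ext (\<lambda>t. max (t - c) 0)" for c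
    by (intro up K_plus_hinge continuous_intros)+
  show "0 \<le> dir_deriv h_ext (\<lambda>_. 1)"
    by (intro up K_plus_const continuous_intros) simp
  have "dir_deriv h_ext h_ext \<le> 0"
  proof (rule down[OF continuous_h_ext, of 1])
    show "(\<lambda>t. h_ext t - \<epsilon> * h_ext t) \<in> K_plus n X" if "0 < \<epsilon>" "\<epsilon> < 1" for \<epsilon>
      using K_plus_cmult[OF _ h_ext_in_K_plus, of "1 - \<epsilon>"] that by (simp add: left_diff_distrib)
  qed simp
  with up[OF continuous_h_ext h_ext_in_K_plus] show "dir_deriv h_ext h_ext = 0" by simp
  show "dir_deriv h_ext (\<lambda>t. max (\<tau> i - t) 0) = 0" if i: "i \<in> {1..k}"
  proof (rule antisym[OF down left])
    show "continuous_on UNIV (\<lambda>t. max (\<tau> i - t) 0)" by (intro continuous_intros)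
    show "0 < \<nu> i" by (rule \<nu>_pos[OF i])
    show "(\<lambda>t. h_ext t - \<epsilon> * max (\<tau> i - t) 0) \<in> K_plus n X" if "0 < \<epsilon>" "\<epsilon> < \<nu> i" for \<epsilon>
    proof -
      have "hinges (\<nu>(i := \<nu> i - \<epsilon>)) \<mu> \<in> K_plus n X"
        using that \<nu>_nonneg \<mu>_nonneg by (intro hinges_in_K_plus) auto
      moreover have "hinges (\<nu>(i := \<nu> i - \<epsilon>)) \<mu> = (\<lambda>t. h_ext t - \<epsilon> * max (\<tau> i - t) 0)"
      proof
        fix t
        have "(\<Sum>j\<in>{1..k}. (\<nu>(i := \<nu> i - \<epsilon>)) j * max (\<tau> j - t) 0) =
            (\<Sum>j\<in>{1..k}. \<nu> j * max (\<tau> j - t) 0 - (if j = i then \<epsilon> * max (\<tau> i - t) 0 else 0))"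
          by (intro sum.cong) (auto simp: left_diff_distrib)
        then show "hinges (\<nu>(i := \<nu> i - \<epsilon>)) \<mu> t = h_ext t - \<epsilon> * max (\<tau> i - t) 0"
          using i by (simp add: hinges_def sum_subtractf)
      qed
      ultimately show ?thesis by simp
    qed
  qed
  show "dir_deriv h_ext (\<lambda>t. max (t - \<eta> j) 0) = 0" if j: "j \<in> {1..m}"
  proof (rule antisym[OF down right])
    show "continuous_on UNIV (\<lambda>t. max (t - \<eta> j) 0)" by (intro continuous_intros)
    show "0 < \<mu> j" by (rule \<mu>_pos[OF j])
    show "(\<lambda>t. h_ext t - \<epsilon> * max (t - \<eta> j) 0) \<in> K_plus n X" if "0 < \<epsilon>" "\<epsilon> < \<mu> j" for \<epsilon>
    proof -
      have "hinges \<nu> (\<mu>(j := \<mu> j - \<epsilon>)) \<in> K_plus n X"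
        using that \<nu>_nonneg \<mu>_nonneg by (intro hinges_in_K_plus) auto
      moreover have "hinges \<nu> (\<mu>(j := \<mu> j - \<epsilon>)) = (\<lambda>t. h_ext t - \<epsilon> * max (t - \<eta> j) 0)"
      proof
        fix t
        have "(\<Sum>i\<in>{1..m}. (\<mu>(j := \<mu> j - \<epsilon>)) i * max (t - \<eta> i) 0) =
            (\<Sum>i\<in>{1..m}. \<mu> i * max (t - \<eta> i) 0 - (if i = j then \<epsilon> * max (t - \<eta> j) 0 else 0))"
          by (intro sum.cong) (auto simp: left_diff_distrib)
        then show "hinges \<nu> (\<mu>(j := \<mu> j - \<epsilon>)) t = h_ext t - \<epsilon> * max (t - \<eta> j) 0"
          using j by (simp add: hinges_def sum_subtractf)
      qed
      ultimately show ?thesis by simp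
    qed
  qed
qed

end

context hinge_hazard
begin

section \<open>The cumulative hazard at points of change of slope\<close>

text \<open>
  To the left of \<open>z = \<tau> i\<close> the increasing hinges vanish. A decreasing hinge at \<open>\<tau> j\<close> cut off at \<open>z\<close> is the hinge at
  \<open>min (\<tau> j) z\<close>, again one of the \<open>\<tau>\<close>'s, plus a multiple of the indicator of \<open>(-\<infinity>, z]\<close>. For
  \<open>z = \<eta> i\<close> the same is done to the right of \<open>z\<close>, and \<open>dir_deriv h h = 0\<close> passes to the complement.
\<close>

lemma dir_deriv_stopped_h_ext:
  assumes min: "minimizes_phi n X h_ext" and z: "z \<in> \<tau> ` {1..k} \<union> \<eta> ` {1..m}"
  shows "dir_deriv h_ext (\<lambda>t. h_ext t * indicator {..z} t) = 0"
proof -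
  note opt = dir_deriv_minimizer[OF min]
  have pos: "0 < h_ext (x i)" if "i \<in> {1..<n}" for i
    using minimizer_positive[OF min that] .
  have int: "integrable surv_measure p" if "continuous_on UNIV p" for p :: "real \<Rightarrow> real"
    using that by (rule integrable_surv_measure_continuous)
  have combination: "dir_deriv h_ext (\<lambda>t. c * A t + (\<Sum>j\<in>J. w j * p j t)) = 0"
    if "integrable surv_measure A" "dir_deriv h_ext A = 0"
      and "\<And>j. j \<in> J \<Longrightarrow> continuous_on UNIV (p j)" "\<And>j. j \<in> J \<Longrightarrow> dir_deriv h_ext (p j) = 0"
    for A p and J :: "nat set" and c and w :: "nat \<Rightarrow> real"
  proof -
    have 1: "integrable surv_measure (\<lambda>t. c * A t)"
      using that(1) by (intro integrable_mult_right)
    have 2: "integrable surv_measure (\<lambda>t. w j * p j t)" if "j \<in> J" for j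
      using \<open>\<And>j. j \<in> J \<Longrightarrow> continuous_on UNIV (p j)\<close>[OF that] by (intro integrable_mult_right int)
    have "dir_deriv h_ext (\<lambda>t. c * A t + (\<Sum>j\<in>J. w j * p j t)) =
        dir_deriv h_ext (\<lambda>t. c * A t) + dir_deriv h_ext (\<lambda>t. \<Sum>j\<in>J. w j * p j t)"
      using 1 2 by (intro dir_deriv_add Bochner_Integration.integrable_sum) auto
    also have "\<dots> = 0"
      using that(2,4) 2 by (simp add: dir_deriv_sum dir_deriv_cmult)
    finally show ?thesis .
  qed
  have int_ind: "integrable surv_measure (indicator S :: real \<Rightarrow> real)" if "S \<in> sets borel" for S
    using that by (intro integrable_surv_measure[of _ 1]) (auto split: split_indicator)
  from z consider i where "i \<in> {1..k}" "z = \<tau> i" | i where "i \<in> {1..m}" "z = \<eta> i" by auto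
  then show ?thesis
  proof cases
    case i: 1
    have "dir_deriv h_ext (\<lambda>t. if 0 \<le> 1 * (z - t) then 1 else 0) = 0"
      using pos opt(1) opt(5)[OF i(1)] \<tau>_in[OF i(1)] i(2)
      by (intro dir_deriv_half_line_eq_0(1)) (auto simp: max.commute)
    also have "(\<lambda>t. if 0 \<le> 1 * (z - t) then 1 else 0) = indicator {..z}"
      by (auto simp: fun_eq_iff)
    finally have A: "dir_deriv h_ext (indicator {..z}) = 0" .
    have "h_ext t * indicator {..z} t = (a + (\<Sum>j\<in>{1..k}. \<nu> j * (\<tau> j - min (\<tau> j) z))) * indicator {..z} t
        + (\<Sum>j\<in>{1..k}. \<nu> j * max (min (\<tau> j) z - t) 0)" for t
    proof (cases "t \<le> z")
      case True
      have "(\<Sum>j\<in>{1..m}. \<mu> j * max (t - \<eta> j) 0) = 0"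
        using True \<tau>_le_\<eta>_all[OF i(1)] i(2) by (intro sum.neutral) force
      moreover have "(\<Sum>j\<in>{1..k}. \<nu> j * max (\<tau> j - t) 0) =
          (\<Sum>j\<in>{1..k}. \<nu> j * (\<tau> j - min (\<tau> j) z) + \<nu> j * max (min (\<tau> j) z - t) 0)"
        using True by (intro sum.cong) (auto simp: min_def max_def algebra_simps)
      ultimately show ?thesis
        using True by (simp add: hinges_def sum.distrib)
    next
      case False
      then have "(\<Sum>j\<in>{1..k}. \<nu> j * max (min (\<tau> j) z - t) 0) = 0"
        by (intro sum.neutral) auto
      then show ?thesis using False by simp
    qed
    moreover have "dir_deriv h_ext (\<lambda>t. max (min (\<tau> j) z - t) 0) = 0" if "j \<in> {1..k}" for j
      using opt(5)[OF that] opt(5)[OF i(1)] i(2) by (auto simp: min_def)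
    ultimately show ?thesis
      using A int_ind by (simp only:) (intro combination continuous_intros, auto)
  next
    case i: 2
    have "dir_deriv h_ext (\<lambda>t. if 0 < - 1 * (z - t) then 1 else 0) = 0"
      using pos opt(2) opt(6)[OF i(1)] \<eta>_in[OF i(1)] i(2)
      by (intro dir_deriv_half_line_eq_0(2)) (auto simp: max.commute)
    also have "(\<lambda>t. if 0 < - 1 * (z - t) then 1 else 0) = indicator {z<..}"
      by (auto simp: fun_eq_iff)
    finally have B: "dir_deriv h_ext (indicator {z<..}) = 0" .
    have "h_ext t * indicator {z<..} t = (a + (\<Sum>j\<in>{1..m}. \<mu> j * (max (\<eta> j) z - \<eta> j))) * indicator {z<..} t
        + (\<Sum>j\<in>{1..m}. \<mu> j * max (t - max (\<eta> j) z) 0)" for t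
    proof (cases "z < t")
      case True
      have "(\<Sum>j\<in>{1..k}. \<nu> j * max (\<tau> j - t) 0) = 0"
        using True \<tau>_le_\<eta>_all[OF _ i(1)] i(2) by (intro sum.neutral) force
      moreover have "(\<Sum>j\<in>{1..m}. \<mu> j * max (t - \<eta> j) 0) =
          (\<Sum>j\<in>{1..m}. \<mu> j * (max (\<eta> j) z - \<eta> j) + \<mu> j * max (t - max (\<eta> j) z) 0)"
        using True by (intro sum.cong) (auto simp: max_def algebra_simps)
      ultimately show ?thesis
        using True by (simp add: hinges_def sum.distrib)
    next
      case False
      then have "(\<Sum>j\<in>{1..m}. \<mu> j * max (t - max (\<eta> j) z) 0) = 0"
        by (intro sum.neutral) auto
      then show ?thesis using False by simp
    qed
    moreover have "dir_deriv h_ext (\<lambda>t. max (t - max (\<eta> j) z) 0) = 0" if "j \<in> {1..m}" for j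
      using opt(6)[OF that] opt(6)[OF i(1)] i(2) by (auto simp: max_def)
    ultimately have "dir_deriv h_ext (\<lambda>t. h_ext t * indicator {z<..} t) = 0"
      using B int_ind by (simp only:) (intro combination continuous_intros, auto)
    moreover have "dir_deriv h_ext (\<lambda>t. h_ext t * indicator {..z} t + h_ext t * indicator {z<..} t)
        = dir_deriv h_ext (\<lambda>t. h_ext t * indicator {..z} t) + dir_deriv h_ext (\<lambda>t. h_ext t * indicator {z<..} t)"
      by (intro dir_deriv_add integrable_real_mult_indicator int continuous_h_ext) auto
    moreover have "(\<lambda>t. h_ext t * indicator {..z} t + h_ext t * indicator {z<..} t) = h_ext"
      by (auto simp: fun_eq_iff split: split_indicator)
    ultimately show ?thesis
      using opt(4) by simp
  qed
qed

text \<open>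
  A vanishing directional derivative along \<open>h 1\<^bsub>(-\<infinity>,z]\<^esub>\<close> equates \<open>\<integral>\<^sub>0\<^sup>z h \<S>\<^sub>n ds\<close> with \<open>1/n\<close> times the number of
  the first \<open>n - 1\<close> sample points up to \<open>z\<close>. Leaving out \<open>x n = b\<close> changes nothing as \<open>z < b\<close>.
\<close>

lemma cum_hazard_at_slope_change:
  assumes min: "minimizes_phi n X h_ext" and z: "z \<in> \<tau> ` {1..k} \<union> \<eta> ` {1..m}"
  shows "(\<integral>\<^sup>+ t\<in>{0..z}. ennreal (h t * emp_surv n X t) \<partial>lborel) = ennreal (emp_df n X z)"
proof -
  have "z < b" using z \<tau>_in \<eta>_in by auto
  have pos: "0 < h_ext (x i)" if "i \<in> {1..<n}" for i
    using minimizer_positive[OF min that] .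
  have [measurable]: "h_ext \<in> borel_measurable borel"
    using continuous_h_ext by (rule borel_measurable_continuous_onI)
  have "(\<integral>\<^sup>+ t\<in>{0..z}. ennreal (h t * emp_surv n X t) \<partial>lborel) =
      (\<integral>\<^sup>+ s\<in>{0..}. ennreal (emp_surv n X s) * ennreal (h_ext s * indicator {..z} s) \<partial>lborel)"
    using \<open>z < b\<close> by (intro nn_integral_cong)
      (auto simp: h_eq_h_ext ennreal_mult h_ext_nonneg emp_surv_nonneg mult.commute split: split_indicator)
  also have "\<dots> = (\<integral>\<^sup>+ s. ennreal (h_ext s * indicator {..z} s) \<partial>surv_measure)"
    by (subst nn_integral_surv_measure) auto
  also have "\<dots> = ennreal (expected_cum (\<lambda>s. h_ext s * indicator {..z} s))"
    by (intro nn_integral_surv_measure_real integrable_real_mult_indicator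
        integrable_surv_measure_continuous continuous_h_ext) (auto simp: h_ext_nonneg)
  also have "expected_cum (\<lambda>s. h_ext s * indicator {..z} s) =
      1 / real n * (\<Sum>i\<in>{1..<n}. h_ext (x i) * indicator {..z} (x i) / h_ext (x i))"
    using dir_deriv_stopped_h_ext[OF min z] by (simp add: dir_deriv_def)
  also have "(\<Sum>i\<in>{1..<n}. h_ext (x i) * indicator {..z} (x i) / h_ext (x i)) = (\<Sum>i\<in>{1..<n}. indicator {x i..} z)"
    using pos by (intro sum.cong) (auto simp: less_imp_neq[symmetric] split: split_indicator)
  also have "\<dots> = (\<Sum>i\<in>{1..n}. indicator {x i..} z)"
    using \<open>z < b\<close> n_pos by (subst atLeastLessThanSuc_atLeastAtMost[symmetric]) (simp add: sum.atLeastLessThan_Suc)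
  also have "1 / real n * \<dots> = emp_df n X z"
    by (simp add: emp_df_jumps)
  finally show ?thesis .
qed

section \<open>Characterization of the minimizer\<close>

lemma minimizes_phi_iff:
  "minimizes_phi n X h \<longleftrightarrow>
    ((\<forall>c\<ge>0. (\<integral>\<^sup>+ t\<in>{0..c}. ennreal (c - t) / ennreal (h t) \<partial>emp_measure_tilde n X)
            \<le> (\<integral>\<^sup>+ t\<in>{0..c}. (\<integral>\<^sup>+ s\<in>{0..t}. ennreal (emp_surv n X s) \<partial>lborel) \<partial>lborel)) \<and>
     (\<forall>i\<in>{1..k}. (\<integral>\<^sup>+ t\<in>{0..\<tau> i}. ennreal (\<tau> i - t) / ennreal (h t) \<partial>emp_measure_tilde n X)
            = (\<integral>\<^sup>+ t\<in>{0..\<tau> i}. (\<integral>\<^sup>+ s\<in>{0..t}. ennreal (emp_surv n X s) \<partial>lborel) \<partial>lborel))) \<and>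
    ((\<forall>c\<ge>0. (\<integral>\<^sup>+ t\<in>{c..}. ennreal (t - c) / ennreal (h t) \<partial>emp_measure_tilde n X)
            \<le> (\<integral>\<^sup>+ t\<in>{c..}. (\<integral>\<^sup>+ s\<in>{t..}. ennreal (emp_surv n X s) \<partial>lborel) \<partial>lborel)) \<and>
     (\<forall>j\<in>{1..m}. (\<integral>\<^sup>+ t\<in>{\<eta> j..}. ennreal (t - \<eta> j) / ennreal (h t) \<partial>emp_measure_tilde n X)
            = (\<integral>\<^sup>+ t\<in>{\<eta> j..}. (\<integral>\<^sup>+ s\<in>{t..}. ennreal (emp_surv n X s) \<partial>lborel) \<partial>lborel))) \<and>
    (\<integral>\<^sup>+ t\<in>{0..}. 1 / ennreal (h t) \<partial>emp_measure_tilde n X)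
      \<le> (\<integral>\<^sup>+ t\<in>{0..}. ennreal (emp_surv n X t) \<partial>lborel) \<and>
    (\<integral>\<^sup>+ t\<in>{0..}. cum_hazard h t \<partial>emp_measure n X) = ennreal (1 - 1 / real n)"
  (is "_ \<longleftrightarrow> ((\<forall>c\<ge>0. ?L c) \<and> (\<forall>i\<in>_. ?Le i)) \<and> ((\<forall>c\<ge>0. ?R c) \<and> (\<forall>j\<in>_. ?Re j)) \<and> ?C \<and> ?H")
proof (cases "\<forall>i\<in>{1..<n}. 0 < h (x i)")
  case False
  then show ?thesis
    using minimizer_positive positive_of_constant_condition by blast
next
  case True
  then have pos: "\<And>i. i \<in> {1..<n} \<Longrightarrow> 0 < h (x i)" by auto
  have h_x: "h (x i) = h_ext (x i)" if "i \<in> {1..<n}" for i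
    using that x_pos[of i] x_less_b[of i] by (intro h_eq_h_ext) auto
  have slope: "dir_deriv h p = dir_deriv h_ext p" for p
    by (simp add: dir_deriv_def h_x)
  have "cum_hazard h (x i) = cum_hazard h_ext (x i)" if "i \<in> {1..n}" for i
    unfolding cum_hazard_def
    by (rule nn_integral_cong_AE, rule AE_mp[OF AE_lborel_singleton[of b]])
      (use x_le_b[OF that] in \<open>auto simp: h_eq_h_ext split: split_indicator\<close>)
  then have "(\<integral>\<^sup>+ t\<in>{0..}. cum_hazard h t \<partial>emp_measure n X) = (\<integral>\<^sup>+ t\<in>{0..}. cum_hazard h_ext t \<partial>emp_measure n X)"
    by (simp add: nn_integral_emp_measure)
  then have H: "?H \<longleftrightarrow> dir_deriv h_ext h_ext = 0"
    using cum_hazard_condition_iff[OF continuous_h_ext h_ext_nonneg] pos h_x by simp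
  have L: "?L c \<longleftrightarrow> 0 \<le> dir_deriv h_ext (\<lambda>t. max (c - t) 0)"
    and R: "?R c \<longleftrightarrow> 0 \<le> dir_deriv h_ext (\<lambda>t. max (t - c) 0)" if "0 \<le> c" for c
    using left_condition_iff(1)[of h c, OF pos that] right_condition_iff(1)[of h c, OF pos that] by (simp_all add: slope)
  have Le: "?Le i \<longleftrightarrow> dir_deriv h_ext (\<lambda>t. max (\<tau> i - t) 0) = 0" if "i \<in> {1..k}" for i
    using left_condition_iff(2)[of h, OF pos, of "\<tau> i"] \<tau>_in[OF that] by (simp add: slope)
  have Re: "?Re j \<longleftrightarrow> dir_deriv h_ext (\<lambda>t. max (t - \<eta> j) 0) = 0" if "j \<in> {1..m}" for j
    using right_condition_iff(2)[of h, OF pos, of "\<eta> j"] \<eta>_in[OF that] by (simp add: slope)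
  have C: "?C \<longleftrightarrow> 0 \<le> dir_deriv h_ext (\<lambda>_. 1)"
    using constant_condition_iff[of h, OF pos] by (simp add: slope)
  show ?thesis
  proof
    assume "minimizes_phi n X h"
    then have "minimizes_phi n X h_ext" by (simp add: minimizes_phi_h_ext)
    note optimal = dir_deriv_minimizer[OF this]
    show "((\<forall>c\<ge>0. ?L c) \<and> (\<forall>i\<in>{1..k}. ?Le i)) \<and>
        ((\<forall>c\<ge>0. ?R c) \<and> (\<forall>j\<in>{1..m}. ?Re j)) \<and> ?C \<and> ?H"
      by (intro conjI allI ballI impI; simp only: L R Le Re C H optimal)
  next
    assume "((\<forall>c\<ge>0. ?L c) \<and> (\<forall>i\<in>{1..k}. ?Le i)) \<and> ((\<forall>c\<ge>0. ?R c) \<and> (\<forall>j\<in>{1..m}. ?Re j)) \<and> ?C \<and> ?H"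
    then have "minimizes_phi n X h_ext"
      using L R C H pos h_x
      by (intro minimizer_if_dir_deriv_nonneg h_ext_in_K_plus continuous_h_ext) auto
    then show "minimizes_phi n X h" by (simp add: minimizes_phi_h_ext)
  qed
qed

end

theorem lemma2p2:
  fixes n k m :: nat
    and X :: "nat \<Rightarrow> real"
    and h :: "real \<Rightarrow> real"
    and a :: real
    and \<nu> \<tau> \<mu> \<eta> :: "nat \<Rightarrow> real"
  assumes n: "n \<ge> 1"
    and order_pos: "0 < order_stat n X 1"
    and order_strict: "strict_mono_on {1..n} (order_stat n X)"
    and h_K: "h \<in> K_plus n X"
    and h_repr: "\<And>t. 0 \<le> t \<Longrightarrow> t < order_stat n X n \<Longrightarrow>
        h t = a + (\<Sum>j\<in>{1..k}. \<nu> j * max (\<tau> j - t) 0) + (\<Sum>j\<in>{1..m}. \<mu> j * max (t - \<eta> j) 0)"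
    and a_nonneg: "0 \<le> a"
    and \<nu>_nonneg: "\<And>j. j \<in> {1..k} \<Longrightarrow> 0 \<le> \<nu> j"
    and \<mu>_nonneg: "\<And>j. j \<in> {1..m} \<Longrightarrow> 0 \<le> \<mu> j"
    and \<tau>_strict: "strict_mono_on {1..k} \<tau>"
    and \<eta>_strict: "strict_mono_on {1..m} \<eta>"
    and \<tau>_slope: "\<tau> ` {1..k} = decreasing_slope_changes h (order_stat n X n)"
    and \<eta>_slope: "\<eta> ` {1..m} = increasing_slope_changes h (order_stat n X n)"
    and \<eta>_pos: "\<And>j. j \<in> {1..m} \<Longrightarrow> 0 < \<eta> j"
    and \<tau>_le_\<eta>: "k \<ge> 1 \<Longrightarrow> m \<ge> 1 \<Longrightarrow> \<tau> k \<le> \<eta> 1"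
  shows
    "(minimizes_phi n X h \<longleftrightarrow>
        ((\<forall>x\<ge>0. (\<integral>\<^sup>+ t\<in>{0..x}. ennreal (x - t) / ennreal (h t) \<partial>emp_measure_tilde n X)
                \<le> (\<integral>\<^sup>+ t\<in>{0..x}. (\<integral>\<^sup>+ s\<in>{0..t}. ennreal (emp_surv n X s) \<partial>lborel) \<partial>lborel)) \<and>
         (\<forall>i\<in>{1..k}. (\<integral>\<^sup>+ t\<in>{0..\<tau> i}. ennreal (\<tau> i - t) / ennreal (h t) \<partial>emp_measure_tilde n X)
                = (\<integral>\<^sup>+ t\<in>{0..\<tau> i}. (\<integral>\<^sup>+ s\<in>{0..t}. ennreal (emp_surv n X s) \<partial>lborel) \<partial>lborel))) \<and>
        ((\<forall>x\<ge>0. (\<integral>\<^sup>+ t\<in>{x..}. ennreal (t - x) / ennreal (h t) \<partial>emp_measure_tilde n X)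
                \<le> (\<integral>\<^sup>+ t\<in>{x..}. (\<integral>\<^sup>+ s\<in>{t..}. ennreal (emp_surv n X s) \<partial>lborel) \<partial>lborel)) \<and>
         (\<forall>j\<in>{1..m}. (\<integral>\<^sup>+ t\<in>{\<eta> j..}. ennreal (t - \<eta> j) / ennreal (h t) \<partial>emp_measure_tilde n X)
                = (\<integral>\<^sup>+ t\<in>{\<eta> j..}. (\<integral>\<^sup>+ s\<in>{t..}. ennreal (emp_surv n X s) \<partial>lborel) \<partial>lborel))) \<and>
        (\<integral>\<^sup>+ t\<in>{0..}. 1 / ennreal (h t) \<partial>emp_measure_tilde n X)
          \<le> (\<integral>\<^sup>+ t\<in>{0..}. ennreal (emp_surv n X t) \<partial>lborel) \<and>
        (\<integral>\<^sup>+ t\<in>{0..}. cum_hazard h t \<partial>emp_measure n X) = ennreal (1 - 1 / real n)) \<and>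
     (minimizes_phi n X h \<longrightarrow> is_MLE n X (extend_infinity n X h)) \<and>
     (minimizes_phi n X h \<longrightarrow>
        (\<forall>x \<in> \<tau> ` {1..k} \<union> \<eta> ` {1..m}.
           (\<integral>\<^sup>+ t\<in>{0..x}. ennreal (h t * emp_surv n X t) \<partial>lborel) = ennreal (emp_df n X x)))"
proof -
  interpret hinge_hazard n X k m h a \<nu> \<tau> \<mu> \<eta>
    by unfold_locales fact+
  show ?thesis
    using minimizes_phi_iff cum_hazard_at_slope_change
    unfolding is_MLE_def minimizes_phi_h_ext[symmetric] by blast
qed

end
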